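(* Let $G$ be a group and $C$ a proper subgroup. Then the following conditions are equivalent: (a) All the elements of $\mathcal{CO}_C(G)$ are isolated (in the space $\mathcal{CO}_C(G)$) and $\mathcal{CO}_C(G)$ is non-empty. (b) There exists an element of $\mathcal{CO}_C(G)$ that is isolated (in $\mathcal{CO}_C(G)$). (c) There exists a finite rational series $G_0\trianglelefteq G_1\trianglelefteq\cdots\trianglelefteq G_n=G$ with $G_0=C$ and without abelian jumps. (d) There exists a unique finite rational series $G_0\trianglelefteq G_1\trianglelefteq\cdots\trianglelefteq G_n=G$ with $G_0=C$, and this series does not have abelian jumps. (e) $\mathcal{CO}_C(G)$ is finite and non-empty. Moreover, under these equivalent conditions, $|\mathcal{CO}_C(G)|=2^n$, where $n$ is the length of any series as in (c) and (d).
   Context: A left-preorder on a group $G$ is a binary relation $\preceq$ on $G$ that is total, transitive and reflexive, that is left-invariant ($\alpha_1\preceq\alpha_2$ implies $\alpha\alpha_1\preceq\alpha\alpha_2$), and that is not the trivial relation (the one with $\alpha_1\preceq\alpha_2$ for all $\alpha_1,\alpha_2$). Write $\alpha\prec\beta$ if $\alpha\preceq\beta$ and not $\beta\preceq\alpha$. The set $C=\{\alpha\in G: \alpha\preceq 1\text{ and }1\preceq\alpha\}$ is a proper subgroup of $G$, and $\preceq$ is called a left-preorder on $G$ relative to $C$. Its positive cone is $P=\{\alpha\in G:1\prec\alpha\}$, and $G=P\sqcup P^{-1}\sqcup C$. A left-preorder is Conradian if for all $\alpha,\beta\in G$ with $1\prec\alpha$ and $1\prec\beta$ there is $n\in\mathbb{N}$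 ($0\in\mathbb N$) with $\alpha\prec\beta\alpha^n$. For a proper subgroup $C$, $\mathcal{CO}_C(G)$ is the set of Conradian left-preorders on $G$ relative to $C$. Topology: each left-preorder is identified with the map $G\to\{\pm1,0\}$ sending $P$ to $1$, $P^{-1}$ to $-1$ and $C$ to $0$. The set $\mathcal{CO}_C(G)$ carries the subspace topology from $\{\pm1,0\}^G$ with the product topology ($\{\pm1,0\}$ discrete). A rational series is a finite series of subgroups $G_0\trianglelefteq G_1\trianglelefteq\cdots\trianglelefteq G_n$ such that each $G_i$ is normal in $G_{i+1}$ and $G_{i+1}/G_i$ is torsion-free abelian of rank $1$ for all $0\le i<n$; its length is $n$. An abelian jump of the series is a subseries $G_i\trianglelefteq G_{i+1}\trianglelefteq G_{i+2}$ ($0\le i\le n-2$) such that $G_i$ is normal in $G_{i+2}$ and $G_{i+2}/G_i$ is abelian. In (d), uniqueness is among all rational series with $G_n=G$ and $G_0=C$. *)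

theory Defs
  imports "HOL-Analysis.Analysis" "HOL-Algebra.Algebra"
begin

text \<open>
  The pair \<open>(\<alpha>, \<beta>) \<in> R\<close> stands for \<open>\<alpha> \<preceq> \<beta>\<close>.  A left-preorder is required to be a subset of
  \<open>carrier G \<times> carrier G\<close> (this is part of \<^const>\<open>preorder_on\<close>), so that left-preorders can be
  compared by equality and counted.
\<close>

definition left_preorder :: "('a, 'm) monoid_scheme \<Rightarrow> 'a rel \<Rightarrow> bool" where
  "left_preorder G R \<longleftrightarrow>
     preorder_on (carrier G) R \<and> total_on (carrier G) R \<and>
     (\<forall>\<alpha>\<in>carrier G. \<forall>(\<alpha>1, \<alpha>2)\<in>R. (\<alpha> \<otimes>\<^bsub>G\<^esub> \<alpha>1, \<alpha> \<otimes>\<^bsub>G\<^esub> \<alpha>2) \<in> R) \<and>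
     R \<noteq> carrier G \<times> carrier G"

definition strictly :: "'a rel \<Rightarrow> 'a \<Rightarrow> 'a \<Rightarrow> bool" where
  "strictly R \<alpha> \<beta> \<longleftrightarrow> (\<alpha>, \<beta>) \<in> R \<and> (\<beta>, \<alpha>) \<notin> R"

definition preorder_residue :: "('a, 'm) monoid_scheme \<Rightarrow> 'a rel \<Rightarrow> 'a set" where
  "preorder_residue G R = {\<alpha> \<in> carrier G. (\<alpha>, \<one>\<^bsub>G\<^esub>) \<in> R \<and> (\<one>\<^bsub>G\<^esub>, \<alpha>) \<in> R}"

definition positive_cone :: "('a, 'm) monoid_scheme \<Rightarrow> 'a rel \<Rightarrow> 'a set" where
  "positive_cone G R = {\<alpha> \<in> carrier G. strictly R \<one>\<^bsub>G\<^esub> \<alpha>}"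

definition conradian :: "('a, 'm) monoid_scheme \<Rightarrow> 'a rel \<Rightarrow> bool" where
  "conradian G R \<longleftrightarrow>
     (\<forall>\<alpha>\<in>carrier G. \<forall>\<beta>\<in>carrier G.
        strictly R \<one>\<^bsub>G\<^esub> \<alpha> \<and> strictly R \<one>\<^bsub>G\<^esub> \<beta> \<longrightarrow>
        (\<exists>n::nat. strictly R \<alpha> (\<beta> \<otimes>\<^bsub>G\<^esub> \<alpha> [^]\<^bsub>G\<^esub> n)))"

definition CO :: "('a, 'm) monoid_scheme \<Rightarrow> 'a set \<Rightarrow> 'a rel set" where
  "CO G C = {R. left_preorder G R \<and> conradian G R \<and> preorder_residue G R = C}"


definition sign_map :: "('a, 'm) monoid_scheme \<Rightarrow> 'a rel \<Rightarrow> 'a \<Rightarrow> int" where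
  "sign_map G R =
     (\<lambda>\<alpha>\<in>carrier G. if \<alpha> \<in> positive_cone G R then 1
                   else if \<alpha> \<in> set_inv\<^bsub>G\<^esub> (positive_cone G R) then - 1 else 0)"

text \<open>
  \<^const>\<open>sign_map\<close> is injective on left-preorders (lemma \<open>inj_on_sign_map\<close> below), so pulling back
  the product topology along it is the same as identifying \<open>CO G C\<close> with its image in
  \<open>{- 1, 0, 1}\<^sup>G\<close> and giving the image the subspace topology.
\<close>

definition CO_space :: "('a, 'm) monoid_scheme \<Rightarrow> 'a set \<Rightarrow> 'a rel topology" where
  "CO_space G C =
     pullback_topology (CO G C) (sign_map G)
       (product_topology (\<lambda>_. discrete_topology {- 1, 0, 1}) (carrier G))"

definition isolated_point :: "'b topology \<Rightarrow> 'b \<Rightarrow> bool" where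
  "isolated_point T x \<longleftrightarrow> x \<in> topspace T \<and> openin T {x}"

lemma topspace_CO_space [simp]: "topspace (CO_space G C) = CO G C"
  by (auto simp: CO_space_def topspace_pullback_topology sign_map_def split: if_splits)


lemma left_preorder_strictly_iff:
  assumes "group G" "left_preorder G R" "\<alpha> \<in> carrier G" "\<beta> \<in> carrier G"
  shows "(\<alpha>, \<beta>) \<in> R \<longleftrightarrow> inv\<^bsub>G\<^esub> \<beta> \<otimes>\<^bsub>G\<^esub> \<alpha> \<notin> positive_cone G R"
proof -
  interpret group G by fact
  have L: "(\<gamma> \<otimes>\<^bsub>G\<^esub> x, \<gamma> \<otimes>\<^bsub>G\<^esub> y) \<in> R" if "\<gamma> \<in> carrier G" "(x, y) \<in> R" for \<gamma> x y
    using assms(2) that unfolding left_preorder_def by blast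
  have shift: "(\<gamma> \<otimes>\<^bsub>G\<^esub> x, \<gamma> \<otimes>\<^bsub>G\<^esub> y) \<in> R \<longleftrightarrow> (x, y) \<in> R"
    if "\<gamma> \<in> carrier G" "x \<in> carrier G" "y \<in> carrier G" for \<gamma> x y
    using L[OF that(1), of x y] L[of "inv\<^bsub>G\<^esub> \<gamma>" "\<gamma> \<otimes>\<^bsub>G\<^esub> x" "\<gamma> \<otimes>\<^bsub>G\<^esub> y"] that
    by (simp add: m_assoc[symmetric]) blast
  have tot: "(x, y) \<in> R \<or> (y, x) \<in> R" if "x \<in> carrier G" "y \<in> carrier G" for x y
    using assms(2) that
    by (cases "x = y") (simp_all add: left_preorder_def preorder_on_def refl_on_def total_on_def)
  show ?thesis
    using shift[of "inv\<^bsub>G\<^esub> \<beta>" \<alpha> \<beta>] shift[of "inv\<^bsub>G\<^esub> \<beta>" \<beta> \<alpha>] tot[of \<alpha> \<beta>] assms(3,4)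
    by (auto simp: positive_cone_def strictly_def)
qed

lemma inj_on_sign_map:
  assumes "group G"
  shows "inj_on (sign_map G) {R. left_preorder G R}"
proof (rule inj_onI)
  fix R S assume RS: "R \<in> {R. left_preorder G R}" "S \<in> {R. left_preorder G R}"
    and eq: "sign_map G R = sign_map G S"
  have *: "\<alpha> \<in> positive_cone G T \<longleftrightarrow> \<alpha> \<in> carrier G \<and> sign_map G T \<alpha> = 1" for \<alpha> T
    by (cases "\<alpha> \<in> carrier G") (simp_all add: sign_map_def positive_cone_def)
  have "positive_cone G R = positive_cone G S"
    unfolding set_eq_iff * eq by simp
  then have iff: "(\<alpha>, \<beta>) \<in> R \<longleftrightarrow> (\<alpha>, \<beta>) \<in> S"
    if "\<alpha> \<in> carrier G" "\<beta> \<in> carrier G" for \<alpha> \<beta>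
    using left_preorder_strictly_iff[OF assms _ that] RS by simp
  have "R \<subseteq> carrier G \<times> carrier G" "S \<subseteq> carrier G \<times> carrier G"
    using RS by (simp_all add: left_preorder_def preorder_on_def)
  then show "R = S"
    using iff by fast
qed


definition torsion_free :: "('a, 'm) monoid_scheme \<Rightarrow> bool" where
  "torsion_free A \<longleftrightarrow>
     (\<forall>x\<in>carrier A. \<forall>n::nat. n > 0 \<and> x [^]\<^bsub>A\<^esub> n = \<one>\<^bsub>A\<^esub> \<longrightarrow> x = \<one>\<^bsub>A\<^esub>)"

definition int_independent :: "('a, 'm) monoid_scheme \<Rightarrow> 'a set \<Rightarrow> bool" where
  "int_independent A S \<longleftrightarrow> S \<subseteq> carrier A \<and>
     (\<forall>F c. finite F \<and> F \<subseteq> S \<and> (\<Otimes>\<^bsub>A\<^esub>x\<in>F. x [^]\<^bsub>A\<^esub> (c x :: int)) = \<one>\<^bsub>A\<^esub> \<longrightarrow> (\<forall>x\<in>F. c x = 0))"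

text \<open>
  The rank of an abelian group is the cardinality of a maximal \<open>\<int>\<close>-independent subset; it does
  not depend on the choice of that subset.
\<close>

definition has_rank :: "('a, 'm) monoid_scheme \<Rightarrow> nat \<Rightarrow> bool" where
  "has_rank A r \<longleftrightarrow>
     (\<exists>S. int_independent A S \<and> (\<forall>T. int_independent A T \<and> S \<subseteq> T \<longrightarrow> T = S) \<and>
          finite S \<and> card S = r)"

text \<open>
  The series \<open>G\<^sub>0 \<unlhd> \<dots> \<unlhd> G\<^sub>n\<close> is the list of its \<open>n + 1\<close> terms.
\<close>

definition rational_series :: "('a, 'm) monoid_scheme \<Rightarrow> 'a set list \<Rightarrow> bool" where
  "rational_series G Gs \<longleftrightarrow> Gs \<noteq> [] \<and> (\<forall>H\<in>set Gs. subgroup H G) \<and>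
     (\<forall>i. Suc i < length Gs \<longrightarrow>
        Gs ! i \<lhd> G\<lparr>carrier := Gs ! Suc i\<rparr> \<and>
        comm_group (G\<lparr>carrier := Gs ! Suc i\<rparr> Mod Gs ! i) \<and>
        torsion_free (G\<lparr>carrier := Gs ! Suc i\<rparr> Mod Gs ! i) \<and>
        has_rank (G\<lparr>carrier := Gs ! Suc i\<rparr> Mod Gs ! i) 1)"

definition series_length :: "'a set list \<Rightarrow> nat" where
  "series_length Gs = length Gs - 1"

definition rational_series_from :: "('a, 'm) monoid_scheme \<Rightarrow> 'a set \<Rightarrow> 'a set list \<Rightarrow> bool" where
  "rational_series_from G C Gs \<longleftrightarrow> rational_series G Gs \<and> hd Gs = C \<and> last Gs = carrier G"

definition has_abelian_jump :: "('a, 'm) monoid_scheme \<Rightarrow> 'a set list \<Rightarrow> bool" where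
  "has_abelian_jump G Gs \<longleftrightarrow>
     (\<exists>i. i + 2 < length Gs \<and>
        Gs ! i \<lhd> G\<lparr>carrier := Gs ! (i + 2)\<rparr> \<and>
        comm_group (G\<lparr>carrier := Gs ! (i + 2)\<rparr> Mod Gs ! i))"

end

theory Submission
  imports Defs
begin

text \<open>
  A left-preorder with residue \<open>C\<close> is the same as its positive cone \<open>P\<close>, and orders are spliced
  along convex subgroups \<open>M \<subseteq> N\<close>: the part of \<open>P\<close> in \<open>N - M\<close> may be replaced by any other Conradian
  cone of \<open>N\<close> relative to \<open>M\<close>.  By Conrad and Hoelder, the largest convex subgroup avoiding a
  positive element is normal in the smallest one containing it, with abelian quotient.

  If \<open>P\<close> is isolated, i.e. determined by finitely many positive elements, splicing shows that
  every order on an abelian convex quotient \<open>N/M\<close> is isolated too; since a minimal finite set of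
  positive elements determining an order on an abelian group is a singleton, \<open>N/M\<close> has rank one.
  Hence the convex subgroups form a finite rational series without abelian jumps.

  Conversely, let \<open>N' \<lhd> N \<lhd> H\<close> be rational steps, with \<open>N'\<close> convex in \<open>N\<close> but \<open>N\<close> not convex in
  \<open>H\<close>.  The convex hull of any \<open>h \<in> N - N'\<close> is then all of \<open>H\<close>, so for the largest convex \<open>U\<close>
  avoiding \<open>h\<close> both \<open>H/U\<close> and \<open>H/N\<close> are abelian; as \<open>U \<inter> N \<subseteq> N'\<close>, so is \<open>H/N'\<close>.  Without abelian
  jumps, the terms of the series are therefore exactly the convex subgroups of every Conradian
  order, which gives uniqueness, and an order amounts to a choice of one of two orders on each
  quotient, which gives the count \<open>2\<^sup>n\<close>.
\<close>

section \<open>Relative cones and convex subgroups\<close>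

text \<open>The residue \<open>C\<close> is in general not normal, so there is no ordered quotient
  group to work in. All orders therefore stay inside the fixed group: a cone of \<open>H\<close>
  relative to \<open>K\<close> orders the left cosets of \<open>K\<close> in \<open>H\<close>, and
  restriction, quotient and splicing become intersection, difference and union of subsets of
  \<open>G\<close>. A genuine quotient is formed only when \<open>K\<close> contains the commutators
  of \<open>H\<close>, which already forces normality. Two points need more than bookkeeping.
  Conrad's exponent depends on the pair of elements, whereas bounding a product by a power of
  \<open>b\<close> needs a uniform one; the exponent 2 always works, and this makes the convex hull
  a subgroup. Finiteness of the series comes from counting: each abelian jump between convex
  subgroups must contain one of the finitely many elements that isolate the order, so the induction
  runs over the number of these elements inside a convex subgroup.\<close>

context group
begin

lemma inv_cancel_left [simp]:
  assumes "x \<in> carrier G" "y \<in> carrier G"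
  shows "inv x \<otimes> (x \<otimes> y) = y" "x \<otimes> (inv x \<otimes> y) = y"
  using assms by (simp_all flip: m_assoc)

lemma subgroup_nat_pow_closed:
  assumes "subgroup H G" "x \<in> H" shows "x [^] (n::nat) \<in> H"
  by (induction n) (use assms in \<open>simp_all add: subgroup.one_closed subgroup.m_closed[OF assms(1)]\<close>)

lemma subgroup_int_pow_closed:
  assumes "subgroup H G" "x \<in> H" shows "x [^] (n::int) \<in> H"
  unfolding int_pow_def2
  using subgroup_nat_pow_closed[OF assms] subgroup.m_inv_closed[OF assms(1)] by presburger

lemma subgroup_inv_iff: "subgroup H G \<Longrightarrow> x \<in> carrier G \<Longrightarrow> inv x \<in> H \<longleftrightarrow> x \<in> H"
  by (metis inv_inv subgroup.m_inv_closed)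

lemma subgroup_mult_left_iff:
  "subgroup H G \<Longrightarrow> x \<in> H \<Longrightarrow> y \<in> carrier G \<Longrightarrow> x \<otimes> y \<in> H \<longleftrightarrow> y \<in> H"
  by (metis inv_cancel_left(1) subgroup.m_closed subgroup.m_inv_closed subgroup.mem_carrier)

lemma subgroup_mult_right_iff:
  assumes "subgroup H G" "y \<in> H" "x \<in> carrier G"
  shows "x \<otimes> y \<in> H \<longleftrightarrow> x \<in> H"
proof
  assume "x \<otimes> y \<in> H"
  then have "x \<otimes> y \<otimes> inv y \<in> H"
    using assms by (simp add: subgroup.m_closed subgroup.m_inv_closed del: r_inv)
  then show "x \<in> H"
    using assms by (simp add: m_assoc subgroup.mem_carrier[OF assms(1)])
qed (use assms in \<open>simp add: subgroup.m_closed\<close>)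

end

text \<open>The element is the commutator x^-1 y^-1 x y. Written for arbitrary sets, the condition
  is monotone in \<open>K\<close> and passes to intersections of such \<open>K\<close>, and it can
  be used before normality of \<open>K\<close> is known.\<close>

definition abelian_over :: "('a, 'm) monoid_scheme \<Rightarrow> 'a set \<Rightarrow> 'a set \<Rightarrow> bool" where
  "abelian_over G K H \<longleftrightarrow>
     (\<forall>x\<in>H. \<forall>y\<in>H. inv\<^bsub>G\<^esub> (y \<otimes>\<^bsub>G\<^esub> x) \<otimes>\<^bsub>G\<^esub> (x \<otimes>\<^bsub>G\<^esub> y) \<in> K)"

text \<open>Membership in \<open>P\<close> says \<open>a < b a^n\<close> for the order
  \<open>x < y\<close> iff x^-1 y lies in \<open>P\<close>. The residue does not occur, so the same
  formula serves for restrictions, quotients and spliced cones.\<close>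

definition conrad :: "('a, 'm) monoid_scheme \<Rightarrow> 'a set \<Rightarrow> bool" where
  "conrad G P \<longleftrightarrow>
     (\<forall>a\<in>P. \<forall>b\<in>P. \<exists>n::nat. inv\<^bsub>G\<^esub> a \<otimes>\<^bsub>G\<^esub> (b \<otimes>\<^bsub>G\<^esub> a [^]\<^bsub>G\<^esub> n) \<in> P)"

text \<open>Positive elements of a left-invariant total order on the left cosets of \<open>K\<close>
  in \<open>H\<close>; normality of \<open>K\<close> is not part of it. The case
  \<open>K = H\<close> with empty \<open>P\<close> is included and starts the inductions along
  chains of subgroups.\<close>

locale cone = group G for G (structure) +
  fixes K H P :: "'a set"
  assumes K_subgroup: "subgroup K G" and H_subgroup: "subgroup H G"
    and K_le_H: "K \<subseteq> H" and P_le_H: "P \<subseteq> H"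
    and P_mult: "x \<in> P \<Longrightarrow> y \<in> P \<Longrightarrow> x \<otimes> y \<in> P"
    and P_cases: "x \<in> H \<Longrightarrow> x \<in> P \<or> inv x \<in> P \<or> x \<in> K"
    and P_inv: "x \<in> P \<Longrightarrow> inv x \<notin> P"
    and P_K: "x \<in> P \<Longrightarrow> x \<notin> K"

lemma (in group) coneI:
  assumes "subgroup K G" "subgroup H G" "K \<subseteq> H" "P \<subseteq> H"
    and "\<And>x y. x \<in> P \<Longrightarrow> y \<in> P \<Longrightarrow> x \<otimes> y \<in> P"
    and "\<And>x. x \<in> H \<Longrightarrow> x \<in> P \<or> inv x \<in> P \<or> x \<in> K"
    and "\<And>x. x \<in> P \<Longrightarrow> inv x \<notin> P"
    and "\<And>x. x \<in> P \<Longrightarrow> x \<notin> K"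
  shows "cone G K H P"
  by (intro cone.intro cone_axioms.intro is_group assms) assumption+

context cone
begin

lemma mem_carrier [simp]: "x \<in> H \<Longrightarrow> x \<in> carrier G" "x \<in> P \<Longrightarrow> x \<in> carrier G" "x \<in> K \<Longrightarrow> x \<in> carrier G"
  using P_le_H K_le_H subgroup.mem_carrier[OF H_subgroup] by auto

lemma mem_H: "x \<in> P \<Longrightarrow> x \<in> H" "x \<in> K \<Longrightarrow> x \<in> H"
  using P_le_H K_le_H by blast+

lemma H_closed [simp]:
  "\<one> \<in> H" "x \<in> H \<Longrightarrow> y \<in> H \<Longrightarrow> x \<otimes> y \<in> H" "x \<in> H \<Longrightarrow> inv x \<in> H"
  "x \<in> H \<Longrightarrow> x [^] (n::nat) \<in> H" "x \<in> H \<Longrightarrow> x [^] (k::int) \<in> H"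
  using H_subgroup by (simp_all add: subgroup.one_closed subgroup.m_closed subgroup.m_inv_closed
      subgroup_nat_pow_closed subgroup_int_pow_closed)

lemma K_closed [simp]:
  "\<one> \<in> K" "x \<in> K \<Longrightarrow> y \<in> K \<Longrightarrow> x \<otimes> y \<in> K" "x \<in> K \<Longrightarrow> inv x \<in> K"
  "x \<in> K \<Longrightarrow> x [^] (n::nat) \<in> K" "x \<in> K \<Longrightarrow> x [^] (k::int) \<in> K"
  using K_subgroup by (simp_all add: subgroup.one_closed subgroup.m_closed subgroup.m_inv_closed
      subgroup_nat_pow_closed subgroup_int_pow_closed)

lemma one_notin_P: "\<one> \<notin> P"
  using P_K K_closed(1) by blast

lemma P_cases3 [consumes 1, case_names pos neg zero]:
  assumes "x \<in> H"
  obtains "x \<in> P" | "inv x \<in> P" | "x \<in> K"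
  using P_cases[OF assms] by blast

lemma inv_P_notin_K: "inv x \<in> P \<Longrightarrow> x \<notin> K"
  using P_K K_closed(3) by blast

text \<open>If \<open>k x\<close> were negative, then x (k x)^-1 = k^-1 would be a positive element
  of \<open>K\<close>. Together with \<open>P_mult_K\<close> this makes \<open>P\<close> a union of
  double cosets of \<open>K\<close>.\<close>

lemma K_mult_P: assumes "k \<in> K" "x \<in> P" shows "k \<otimes> x \<in> P"
proof -
  have "k \<otimes> x \<in> H" using assms mem_H by simp
  then show ?thesis
  proof (cases rule: P_cases3)
    case neg
    then have "x \<otimes> (inv x \<otimes> inv k) \<in> P"
      using P_mult[OF assms(2), of "inv (k \<otimes> x)"] assms by (simp add: inv_mult_group)
    then show ?thesis
      using P_K[of "inv k"] assms by simp
  next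
    case zero
    then show ?thesis
      using P_K[OF assms(2)] assms subgroup_mult_left_iff[OF K_subgroup, of k x] by simp
  qed
qed

lemma P_mult_K: assumes "x \<in> P" "k \<in> K" shows "x \<otimes> k \<in> P"
proof -
  have "x \<otimes> k \<in> H" using assms mem_H by simp
  then show ?thesis
  proof (cases rule: P_cases3)
    case neg
    then have "inv k \<otimes> inv x \<otimes> x \<in> P"
      using P_mult[OF _ assms(1), of "inv (x \<otimes> k)"] assms by (simp add: inv_mult_group)
    then show ?thesis
      using P_K[of "inv k"] assms by (simp add: m_assoc)
  next
    case zero
    then show ?thesis
      using P_K[OF assms(1)] assms subgroup_mult_right_iff[OF K_subgroup, of k x] by simp
  qed
qed

lemma P_pow: "x \<in> P \<Longrightarrow> n > 0 \<Longrightarrow> x [^] (n::nat) \<in> P"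
proof (induction n)
  case (Suc n)
  then show ?case by (cases "n = 0") (auto intro: P_mult)
qed simp

lemma P_pow_mult: "x \<in> P \<Longrightarrow> y \<in> P \<Longrightarrow> x [^] (n::nat) \<otimes> y \<in> P"
  using P_pow[of x n] P_mult by (cases "n = 0") auto

lemma pow_in_K: assumes "x \<in> H" "n > 0" "x [^] (n::nat) \<in> K" shows "x \<in> K"
  using assms(1)
proof (cases rule: P_cases3)
  case pos
  then show ?thesis using P_pow[of x n] P_K assms by blast
next
  case neg
  then have "inv (x [^] n) \<in> P"
    using P_pow[of "inv x" n] assms by (simp add: nat_pow_inv)
  then show ?thesis using inv_P_notin_K assms by blast
qed

lemma pow_in_P: assumes "x \<in> H" "n > 0" "x [^] (n::nat) \<in> P" shows "x \<in> P"
  using assms(1)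
proof (cases rule: P_cases3)
  case neg
  then have "inv (x [^] n) \<in> P"
    using P_pow[of "inv x" n] assms by (simp add: nat_pow_inv)
  then show ?thesis using P_inv assms by blast
next
  case zero
  then show ?thesis using K_closed(4) P_K assms by blast
qed

text \<open>The order is \<open>x < y \<longleftrightarrow> inv x \<otimes> y \<in> P\<close>.\<close>

lemma not_less_mult:
  assumes "x \<in> H" "y \<in> H" "z \<in> H" "inv y \<otimes> x \<notin> P" "inv y \<otimes> z \<in> P"
  shows "inv x \<otimes> z \<in> P"
proof -
  have "inv x \<otimes> z = (inv x \<otimes> y) \<otimes> (inv y \<otimes> z)"
    using assms by (simp add: m_assoc)
  moreover have "inv x \<otimes> y \<in> P \<or> inv x \<otimes> y \<in> K"
    using P_cases[of "inv x \<otimes> y"] assms by (auto simp: inv_mult_group)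
  ultimately show ?thesis
    using P_mult K_mult_P assms by metis
qed

text \<open>Trichotomy leaves no room: an element of \<open>P - Q\<close> would lie in
  \<open>K\<close> or have its inverse in \<open>Q\<close>, hence in \<open>P\<close>. So distinct
  cones are incomparable, and one inclusion suffices to identify two of them.\<close>

lemma sub_cone_eq:
  assumes "cone G K H Q" "Q \<subseteq> P" shows "Q = P"
proof -
  interpret Q: cone G K H Q by fact
  show ?thesis
    using assms(2) P_inv P_K Q.P_cases mem_H by blast
qed

lemma cone_inverse: "cone G K H {x \<in> H. inv x \<in> P}"
proof (rule coneI)
  fix x y assume "x \<in> {x \<in> H. inv x \<in> P}" "y \<in> {x \<in> H. inv x \<in> P}"
  then show "x \<otimes> y \<in> {x \<in> H. inv x \<in> P}"
    using P_mult[of "inv y" "inv x"] by (simp add: inv_mult_group)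
next
  fix x assume "x \<in> H" then show "x \<in> {x \<in> H. inv x \<in> P} \<or> inv x \<in> {x \<in> H. inv x \<in> P} \<or> x \<in> K"
    using P_cases[of x] by auto
qed (use K_subgroup H_subgroup K_le_H P_inv inv_P_notin_K in auto)

text \<open>The exponent 1 works: a^-1 b a is \<open>b\<close> times a commutator, hence
  \<open>b\<close> times an element of \<open>K\<close>, and so positive.\<close>

lemma abelian_conrad:
  assumes "abelian_over G K H" shows "conrad G P"
  unfolding conrad_def
proof (intro ballI)
  fix a b assume ab: "a \<in> P" "b \<in> P"
  have "inv (a \<otimes> b) \<otimes> (b \<otimes> a) \<in> K"
    using assms ab mem_H by (auto simp: abelian_over_def)
  then have "b \<otimes> (inv (a \<otimes> b) \<otimes> (b \<otimes> a)) \<in> P"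
    using P_mult_K ab by blast
  also have "b \<otimes> (inv (a \<otimes> b) \<otimes> (b \<otimes> a)) = inv a \<otimes> (b \<otimes> a [^] (1::nat))"
    using ab by (simp add: inv_mult_group m_assoc)
  finally show "\<exists>n::nat. inv a \<otimes> (b \<otimes> a [^] n) \<in> P" by blast
qed

section \<open>Restriction and lexicographic composition of cones\<close>

lemma cone_restrict:
  assumes "subgroup M G" "K \<subseteq> M" "M \<subseteq> H"
  shows "cone G K M (P \<inter> M)"
proof (rule coneI)
  fix x assume "x \<in> M"
  then show "x \<in> P \<inter> M \<or> inv x \<in> P \<inter> M \<or> x \<in> K"
    using P_cases[of x] assms by (auto simp: subgroup.m_inv_closed)
qed (use assms K_subgroup P_mult P_inv P_K in \<open>auto simp: subgroup.m_closed\<close>)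

lemma conrad_restrict:
  assumes "conrad G P" "subgroup M G"
  shows "conrad G (P \<inter> M)"
  using assms(1) unfolding conrad_def
  by (auto intro!: subgroup.m_closed[OF assms(2)] subgroup.m_inv_closed[OF assms(2)]
      subgroup_nat_pow_closed[OF assms(2)])

text \<open>This is the lexicographic order: \<open>S\<close> decides the sign of elements outside
  \<open>H\<close>, and \<open>P\<close> decides inside. Closure under products holds because
  \<open>S\<close> absorbs factors from its residue \<open>H\<close> on both sides.\<close>

lemma cone_compose:
  assumes "cone G H L S" shows "cone G K L (P \<union> S)"
proof -
  interpret S: cone G H L S by fact
  show ?thesis
  proof (rule coneI)
    fix x y assume "x \<in> P \<union> S" "y \<in> P \<union> S"
    then show "x \<otimes> y \<in> P \<union> S"
      using P_mult S.P_mult S.P_mult_K S.K_mult_P mem_H by blast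
  next
    fix x assume "x \<in> L" then show "x \<in> P \<union> S \<or> inv x \<in> P \<union> S \<or> x \<in> K"
      using S.P_cases P_cases by blast
  next
    fix x assume x: "x \<in> P \<union> S" show "inv x \<notin> P \<union> S"
    proof (cases "x \<in> P")
      case True
      then show ?thesis using P_inv[of x] S.P_K[of "inv x"] mem_H by auto
    next
      case False
      then have "x \<in> S" using x by blast
      then show ?thesis
        using S.P_inv[of x] S.inv_P_notin_K[of "inv x"] S.P_K[of x] mem_H(1)[of "inv x"] S.mem_carrier(2)[of x] by auto
    qed
  qed (use K_subgroup S.H_subgroup K_le_H S.K_le_H P_le_H S.P_le_H P_K S.P_K in auto)
qed

lemma conrad_compose:
  assumes "cone G H L S" "conrad G P" "conrad G S" shows "conrad G (P \<union> S)"
  unfolding conrad_def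
proof (intro ballI)
  interpret S: cone G H L S by fact
  fix a b assume ab: "a \<in> P \<union> S" "b \<in> P \<union> S"
  consider "a \<in> P" "b \<in> P" | "a \<in> S" "b \<in> S" | "a \<in> P" "b \<in> S" | "a \<in> S" "b \<in> P"
    using ab by blast
  then show "\<exists>n::nat. inv a \<otimes> (b \<otimes> a [^] n) \<in> P \<union> S"
  proof cases
    case 1
    then show ?thesis using assms(2) unfolding conrad_def by blast
  next
    case 2
    then show ?thesis using assms(3) unfolding conrad_def by blast
  next
    case 3
    \<comment> \<open>Exponent 0 suffices, because \<open>a\<close> lies in the residue of
      \<open>S\<close>, which \<open>S\<close> absorbs.\<close>
    then have "inv a \<otimes> (b \<otimes> a [^] (0::nat)) \<in> S"
      using S.K_mult_P[of "inv a" b] mem_H by simp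
    then show ?thesis by blast
  next
    case 4
    \<comment> \<open>Here \<open>b\<close> is too small for the condition on \<open>S\<close>. It
      is applied to \<open>b a\<close> instead, and the extra factor raises the exponent by
      one.\<close>
    then have "b \<otimes> a \<in> S" using S.K_mult_P mem_H by blast
    then obtain n :: nat where "inv a \<otimes> ((b \<otimes> a) \<otimes> a [^] n) \<in> S"
      using assms(3) 4 unfolding conrad_def by blast
    moreover have "inv a \<otimes> ((b \<otimes> a) \<otimes> a [^] n) = inv a \<otimes> (b \<otimes> a [^] Suc n)"
      using 4 nat_pow_Suc2[of a n] S.mem_carrier by (simp add: m_assoc)
    ultimately have "inv a \<otimes> (b \<otimes> a [^] Suc n) \<in> P \<union> S" by simp
    then show ?thesis by blast
  qed
qed

text \<open>Replacing \<open>m\<close> by its inverse, the last condition says that a positive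
  element outside \<open>M\<close> lies above all of \<open>M\<close>. For subgroups this is the
  usual interval convexity, in a form that can be applied without producing an interval.\<close>

definition convex :: "'a set \<Rightarrow> bool" where
  "convex M \<longleftrightarrow> subgroup M G \<and> K \<subseteq> M \<and> M \<subseteq> H \<and> (\<forall>x\<in>P - M. \<forall>m\<in>M. m \<otimes> x \<in> P)"

lemma convexD:
  assumes "convex M"
  shows "subgroup M G" "K \<subseteq> M" "M \<subseteq> H" "x \<in> P \<Longrightarrow> x \<notin> M \<Longrightarrow> m \<in> M \<Longrightarrow> m \<otimes> x \<in> P"
  using assms by (auto simp: convex_def)

lemma convex_K: "convex K"
  using K_subgroup K_le_H K_mult_P by (auto simp: convex_def)

lemma convex_H: "convex H"
  using H_subgroup K_le_H P_le_H by (auto simp: convex_def)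

lemma cone_convex_quotient: assumes "convex M" shows "cone G M H (P - M)"
proof -
  note M = convexD[OF assms]
  have Mc: "m \<in> carrier G" if "m \<in> M" for m using that M(3) by auto
  show ?thesis
  proof (rule coneI)
    fix x y assume x: "x \<in> P - M" and y: "y \<in> P - M"
    \<comment> \<open>Otherwise convexity makes (x y)^-1 x = y^-1 positive.\<close>
    have "x \<otimes> y \<notin> M"
    proof
      assume "x \<otimes> y \<in> M"
      then have "inv (x \<otimes> y) \<otimes> x \<in> P"
        using x M(1,4) by (auto simp: subgroup.m_inv_closed)
      then have "inv y \<in> P" using x y by (simp add: inv_mult_group m_assoc)
      then show False using y P_inv by blast
    qed
    then show "x \<otimes> y \<in> P - M" using x y P_mult by blast
  next
    fix x assume "x \<in> H"
    then show "x \<in> P - M \<or> inv x \<in> P - M \<or> x \<in> M"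
      using P_cases[of x] M(2) subgroup_inv_iff[OF M(1), of x] by auto
  qed (use M H_subgroup P_le_H P_inv in auto)
qed

lemma convex_iff_cone:
  "convex M \<longleftrightarrow> K \<subseteq> M \<and> cone G M H (P - M)"
proof
  assume "K \<subseteq> M \<and> cone G M H (P - M)"
  then interpret M: cone G M H "P - M" by simp
  show "convex M"
    using \<open>K \<subseteq> M \<and> _\<close> M.K_subgroup M.K_le_H M.K_mult_P by (auto simp: convex_def)
qed (simp add: cone_convex_quotient convexD)

text \<open>The exponent \<open>n\<close> obtained for \<open>P\<close> may give an element of
  \<open>M\<close>. One further factor \<open>a\<close> then moves it into \<open>P - M\<close>,
  since \<open>P - M\<close> absorbs \<open>M\<close>.\<close>

lemma conrad_convex_quotient:
  assumes "conrad G P" "convex M" shows "conrad G (P - M)"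
  unfolding conrad_def
proof (intro ballI)
  fix a b assume ab: "a \<in> P - M" "b \<in> P - M"
  then obtain n :: nat where n: "inv a \<otimes> (b \<otimes> a [^] n) \<in> P"
    using assms(1) unfolding conrad_def by blast
  interpret Q: cone G M H "P - M" using assms(2) by (rule cone_convex_quotient)
  show "\<exists>n::nat. inv a \<otimes> (b \<otimes> a [^] n) \<in> P - M"
  proof (cases "inv a \<otimes> (b \<otimes> a [^] n) \<in> M")
    case True
    have "inv a \<otimes> (b \<otimes> a [^] Suc n) = inv a \<otimes> (b \<otimes> a [^] n) \<otimes> a"
      using ab by (simp add: m_assoc)
    then have "inv a \<otimes> (b \<otimes> a [^] Suc n) \<in> P - M"
      using Q.K_mult_P[OF True ab(1)] by argo
    then show ?thesis by blast
  qed (use n in blast)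
qed

text \<open>If neither contains the other, there are positive elements \<open>m\<close> of
  \<open>M - N\<close> and \<open>n\<close> of \<open>N - M\<close>. Each would have to exceed the
  other.\<close>

lemma convex_chain: assumes "convex M" "convex N" shows "M \<subseteq> N \<or> N \<subseteq> M"
proof (rule ccontr)
  assume "\<not> ?thesis"
  then obtain m n where "m \<in> M" "m \<notin> N" "n \<in> N" "n \<notin> M" by blast
  note M = convexD[OF assms(1)] and N = convexD[OF assms(2)]
  have "\<exists>m\<in>P. m \<in> M \<and> m \<notin> N"
    using P_cases[of m] \<open>m \<in> M\<close> \<open>m \<notin> N\<close> M(1-3) N(1,2)
    by (metis subgroup.m_inv_closed subgroup_inv_iff subsetD mem_carrier(1))
  moreover have "\<exists>m\<in>P. m \<in> N \<and> m \<notin> M"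
    using P_cases[of n] \<open>n \<in> N\<close> \<open>n \<notin> M\<close> N(1-3) M(1,2)
    by (metis subgroup.m_inv_closed subgroup_inv_iff subsetD mem_carrier(1))
  ultimately obtain m n where mn: "m \<in> P" "m \<in> M" "m \<notin> N" "n \<in> P" "n \<in> N" "n \<notin> M" by blast
  then have "inv m \<otimes> n \<in> P" "inv n \<otimes> m \<in> P"
    using M(1,4) N(1,4) by (auto simp: subgroup.m_inv_closed)
  then show False
    using P_inv[of "inv m \<otimes> n"] mn by (simp add: inv_mult_group)
qed

lemma convex_pow: "convex M \<Longrightarrow> x \<in> H \<Longrightarrow> n > 0 \<Longrightarrow> x [^] (n::nat) \<in> M \<Longrightarrow> x \<in> M"
  using cone.pow_in_K[OF cone_convex_quotient] by blast

lemma convex_trans: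
  assumes "convex M" "cone.convex G K M (P \<inter> M) N" shows "convex N"
proof -
  note M = convexD[OF assms(1)]
  interpret R: cone G K M "P \<inter> M" using cone_restrict[OF M(1-3)] .
  note N = R.convexD[OF assms(2)]
  show ?thesis
    unfolding convex_def using M N by blast
qed

lemma convex_restrict:
  assumes "convex N" "subgroup M G" "K \<subseteq> M" "M \<subseteq> H"
  shows "cone.convex G K M (P \<inter> M) (N \<inter> M)"
proof -
  interpret R: cone G K M "P \<inter> M" using cone_restrict[OF assms(2-4)] .
  have "subgroup (N \<inter> M) G" using convexD(1)[OF assms(1)] assms(2) by (simp add: subgroups_Inter_pair)
  then show ?thesis
    unfolding R.convex_def using convexD[OF assms(1)] assms by (auto simp: subgroup.m_closed)
qed

text \<open>Two lexicographic compositions along the inclusions of \<open>K\<close>,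
  \<open>M\<close>, \<open>N\<close> and \<open>H\<close>. Only the middle layer is changed, so
  elements outside \<open>N - M\<close> keep their signs.\<close>

lemma cone_replace:
  assumes "convex M" "convex N" "cone G M N S"
  shows "cone G K H (P \<inter> M \<union> (S \<union> (P - N)))"
    and "\<lbrakk>conrad G P; conrad G S\<rbrakk> \<Longrightarrow> conrad G (P \<inter> M \<union> (S \<union> (P - N)))"
proof -
  interpret S: cone G M N S by fact
  have 1: "cone G M H (S \<union> (P - N))"
    using S.cone_compose cone_convex_quotient[OF assms(2)] .
  interpret R: cone G K M "P \<inter> M" using cone_restrict[OF convexD(1-3)[OF assms(1)]] .
  show "cone G K H (P \<inter> M \<union> (S \<union> (P - N)))"
    using R.cone_compose[OF 1] .
  show "conrad G (P \<inter> M \<union> (S \<union> (P - N)))" if "conrad G P" "conrad G S"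
    using R.conrad_compose[OF 1] S.conrad_compose[OF cone_convex_quotient[OF assms(2)]] that
      conrad_restrict convexD(1) assms conrad_convex_quotient by blast
qed

end

section \<open>The convex jump at an element\<close>

locale conrad_cone = cone +
  assumes conrad_P: "conrad G P"
begin

text \<open>The exponent 2 is good for every pair: a < b a^2. If instead b a^2 is at most
  \<open>a\<close>, put c = b a. Then all powers of \<open>c\<close> stay below \<open>a\<close>,
  whereas Conrad's condition for \<open>c\<close> and \<open>b\<close> gives c < b c^n < b a = c for
  some \<open>n\<close>.\<close>

lemma conrad_square:
  assumes a: "a \<in> P" and b: "b \<in> P" shows "inv a \<otimes> (b \<otimes> (a \<otimes> a)) \<in> P"
proof (rule ccontr)
  assume neg: "inv a \<otimes> (b \<otimes> (a \<otimes> a)) \<notin> P"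
  define c where "c = b \<otimes> a"
  have c: "c \<in> P" unfolding c_def using a b P_mult by blast
  have ca: "inv a \<otimes> (c \<otimes> a) \<notin> P"
    using neg a b by (simp add: c_def m_assoc)
  \<comment> \<open>That c a is at most \<open>a\<close> can be iterated by left-invariance: c^(n+1)
    a is at most c^n a, hence at most \<open>a\<close>.\<close>
  have 1: "inv a \<otimes> (c [^] n \<otimes> a) \<notin> P" for n :: nat
  proof (induction n)
    case 0
    then show ?case using a one_notin_P by simp
  next
    case (Suc n)
    show ?case
    proof
      assume "inv a \<otimes> (c [^] Suc n \<otimes> a) \<in> P"
      moreover have "inv a \<otimes> (c [^] Suc n \<otimes> a) = (inv a \<otimes> (c [^] n \<otimes> a)) \<otimes> (inv a \<otimes> (c \<otimes> a))"
        using a c by (simp add: m_assoc)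
      ultimately have *: "(inv a \<otimes> (c [^] n \<otimes> a)) \<otimes> (inv a \<otimes> (c \<otimes> a)) \<in> P" by simp
      have "inv (inv a \<otimes> (c [^] n \<otimes> a)) \<in> P \<or> inv a \<otimes> (c [^] n \<otimes> a) \<in> K"
        using Suc P_cases[of "inv a \<otimes> (c [^] n \<otimes> a)"] a c mem_H by auto
      moreover have "inv a \<otimes> (c \<otimes> a) = inv (inv a \<otimes> (c [^] n \<otimes> a)) \<otimes> ((inv a \<otimes> (c [^] n \<otimes> a)) \<otimes> (inv a \<otimes> (c \<otimes> a)))"
        using a c by simp
      ultimately have "inv a \<otimes> (c \<otimes> a) \<in> P"
        using P_mult[OF _ *] K_mult_P[OF _ *] by (metis K_closed(3))
      then show False using ca by blast
    qed
  qed
  \<comment> \<open>Since a^-1 c^n a is at most 1, its inverse is positive or in \<open>K\<close>,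
    and multiplying by \<open>a\<close> on the left gives c^-n a > 1, that is c^n < a.\<close>
  have 2: "inv (c [^] n) \<otimes> a \<in> P" for n :: nat
  proof -
    have "inv (inv a \<otimes> (c [^] n \<otimes> a)) \<in> P \<or> inv (inv a \<otimes> (c [^] n \<otimes> a)) \<in> K"
      using 1[of n] P_cases[of "inv a \<otimes> (c [^] n \<otimes> a)"] a c mem_H K_closed(3) by auto
    then have "a \<otimes> inv (inv a \<otimes> (c [^] n \<otimes> a)) \<in> P"
      using a P_mult P_mult_K by blast
    moreover have "a \<otimes> inv (inv a \<otimes> (c [^] n \<otimes> a)) = a \<otimes> (inv a \<otimes> (inv (c [^] n) \<otimes> a))"
      using a c by (simp add: inv_mult_group m_assoc)
    ultimately show ?thesis using a c by simp
  qed
  obtain n :: nat where n: "inv c \<otimes> (b \<otimes> c [^] n) \<in> P"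
    using conrad_P b c unfolding conrad_def by blast
  have "inv c \<otimes> (b \<otimes> c [^] n) \<otimes> (inv (c [^] n) \<otimes> a) \<in> P"
    using P_mult[OF n 2] .
  moreover have "inv c \<otimes> (b \<otimes> c [^] n) \<otimes> (inv (c [^] n) \<otimes> a) = \<one>"
    using a b c by (simp add: m_assoc flip: c_def)
  ultimately show False using one_notin_P by simp
qed

text \<open>Both \<open>g\<close> and its inverse are bounded above by powers of \<open>b\<close>.
  Bounding the inverse, instead of bounding \<open>g\<close> from below, makes closure under
  inverses immediate and reduces products to upper bounds.\<close>

definition hull_of :: "'a \<Rightarrow> 'a set" where
  "hull_of b = {g \<in> H. (\<exists>n::nat. inv g \<otimes> b [^] n \<in> P) \<and> (\<exists>n::nat. g \<otimes> b [^] n \<in> P)}"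

text \<open>With c = b^n, \<open>conrad_square\<close> applied to the positive element x^-1 b^m
  makes c^-1 (x^-1 b^m) c^2 positive. Multiplying by the positive y^-1 c on the left telescopes to
  (x y)^-1 b^(m+2n).\<close>

lemma below_power_mult:
  assumes "b \<in> P" "x \<in> H" "y \<in> H" "inv x \<otimes> b [^] (m::nat) \<in> P" "inv y \<otimes> b [^] (n::nat) \<in> P"
  shows "\<exists>k::nat. inv (x \<otimes> y) \<otimes> b [^] k \<in> P"
\<comment> \<open>For \<open>n = 0\<close> the element \<open>c\<close> would be trivial and
  \<open>conrad_square\<close> does not apply.\<close>
proof (cases "n = 0")
  case True
  then have "inv y \<in> P" using assms by simp
  then have "inv y \<otimes> (inv x \<otimes> b [^] m) \<in> P" using P_mult assms(4) by blast
  then show ?thesis using assms by (auto simp: inv_mult_group m_assoc)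
next
  case False
  define c where "c = b [^] n"
  have c: "c \<in> P" using P_pow[OF assms(1)] False by (simp add: c_def)
  have "inv y \<otimes> c \<otimes> (inv c \<otimes> (inv x \<otimes> b [^] m \<otimes> (c \<otimes> c))) \<in> P"
    using P_mult[OF assms(5)[folded c_def] conrad_square[OF c assms(4)]] .
  also have "inv y \<otimes> c \<otimes> (inv c \<otimes> (inv x \<otimes> b [^] m \<otimes> (c \<otimes> c))) = inv (x \<otimes> y) \<otimes> b [^] (m + (n + n))"
    using assms(1-3) by (simp add: c_def inv_mult_group m_assoc nat_pow_mult)
  finally show ?thesis by blast
qed

lemma convex_hull: assumes b: "b \<in> P" shows "convex (hull_of b)"
  unfolding convex_def
proof (intro conjI ballI)
  show "subgroup (hull_of b) G"
  proof (rule subgroupI)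
    show "hull_of b \<subseteq> carrier G" by (auto simp: hull_of_def)
    have "\<one> \<otimes> b [^] (1::nat) \<in> P" using b by simp
    then have "\<one> \<in> hull_of b" unfolding hull_of_def by (metis (mono_tags, lifting) H_closed(1) inv_one mem_Collect_eq)
    then show "hull_of b \<noteq> {}" by blast
  next
    fix g assume "g \<in> hull_of b" then show "inv g \<in> hull_of b" by (auto simp: hull_of_def)
  next
    fix g h assume gh: "g \<in> hull_of b" "h \<in> hull_of b"
    then have "\<exists>k::nat. inv (g \<otimes> h) \<otimes> b [^] k \<in> P"
      using below_power_mult[OF b, of g h] unfolding hull_of_def by blast
    moreover have "\<exists>k::nat. inv (inv h \<otimes> inv g) \<otimes> b [^] k \<in> P"
      using below_power_mult[OF b, of "inv h" "inv g"] gh unfolding hull_of_def by auto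
    ultimately show "g \<otimes> h \<in> hull_of b" using gh by (auto simp: hull_of_def inv_mult_group)
  qed
  show "K \<subseteq> hull_of b"
  proof
    fix k assume "k \<in> K"
    then have "inv k \<otimes> b [^] (1::nat) \<in> P" "k \<otimes> b [^] (1::nat) \<in> P" using b K_mult_P by auto
    then show "k \<in> hull_of b" using \<open>k \<in> K\<close> mem_H unfolding hull_of_def by blast
  qed
  show "hull_of b \<subseteq> H" by (auto simp: hull_of_def)
next
  fix x m assume x: "x \<in> P - hull_of b" and m: "m \<in> hull_of b"
  show "m \<otimes> x \<in> P"
  proof (rule ccontr)
    assume *: "m \<otimes> x \<notin> P"
    obtain n :: nat where n: "m \<otimes> b [^] n \<in> P" using m by (auto simp: hull_of_def)
    \<comment> \<open>From the failure of m x > 1 follows that \<open>x\<close> is at most m^-1,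
      which is below b^n.\<close>
    have "inv x \<otimes> b [^] n \<in> P"
      using not_less_mult[of x "inv m" "b [^] n"] * n m x b mem_H by (auto simp: hull_of_def)
    moreover have "x \<otimes> b [^] (0::nat) \<in> P" using x by simp
    ultimately have "x \<in> hull_of b" using x mem_H unfolding hull_of_def by blast
    then show False using x by blast
  qed
qed

lemma mem_hull: assumes b: "b \<in> P" shows "b \<in> hull_of b"
proof -
  have "inv b \<otimes> b [^] (2::nat) \<in> P" "b \<otimes> b [^] (0::nat) \<in> P"
    using b by (simp_all add: numeral_2_eq_2 flip: m_assoc)
  then show ?thesis using b mem_H unfolding hull_of_def by blast
qed

text \<open>A positive element outside \<open>M\<close> exceeds every power of \<open>b\<close>, as
  these lie in \<open>M\<close>; this contradicts one of the two bounds, applied to \<open>g\<close>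
  or to its inverse.\<close>

lemma hull_least: assumes "convex M" "b \<in> P" "b \<in> M" shows "hull_of b \<subseteq> M"
proof
  note M = convexD[OF assms(1)]
  have bM: "b [^] n \<in> M" for n :: nat using M(1) assms(3) by (rule subgroup_nat_pow_closed)
  fix g assume g: "g \<in> hull_of b"
  then obtain n m :: nat where n: "g \<in> H" "inv g \<otimes> b [^] n \<in> P" "g \<otimes> b [^] m \<in> P"
    by (auto simp: hull_of_def)
  show "g \<in> M"
  proof (rule ccontr)
    assume "g \<notin> M"
    then have "inv g \<notin> M" using M(1) n by (simp add: subgroup_inv_iff)
    from n(1) show False
    proof (cases rule: P_cases3)
      case pos
      then have "inv (b [^] n) \<otimes> g \<in> P" using M(1,4) bM \<open>g \<notin> M\<close> by (simp add: subgroup.m_inv_closed)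
      then show False using P_inv[OF n(2)] n assms(2) by (simp add: inv_mult_group)
    next
      case neg
      then have "inv (b [^] m) \<otimes> inv g \<in> P" using M(1,4) bM \<open>inv g \<notin> M\<close> by (simp add: subgroup.m_inv_closed)
      then show False using P_inv[OF n(3)] n assms(2) by (simp add: inv_mult_group)
    next
      case zero
      then show False using M(2) \<open>g \<notin> M\<close> by blast
    qed
  qed
qed

definition under :: "'a \<Rightarrow> 'a set" where
  "under b = \<Union>{M. convex M \<and> b \<notin> M}"

lemma not_mem_under: "b \<notin> under b"
  by (auto simp: under_def)

lemma subset_under: "convex M \<Longrightarrow> b \<notin> M \<Longrightarrow> M \<subseteq> under b"
  by (auto simp: under_def)

text \<open>The convex subgroups missing \<open>b\<close> form a chain, so any two elements of the
  union already lie in one member, and convexity can be tested in a single member.\<close>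

lemma convex_under: assumes b: "b \<in> P" shows "convex (under b)"
  unfolding convex_def
proof (intro conjI ballI)
  have bK: "convex K" "b \<notin> K" using convex_K P_K b by auto
  show "K \<subseteq> under b" using subset_under bK by blast
  show "under b \<subseteq> H" using convexD(3) unfolding under_def by blast
  show "subgroup (under b) G"
  proof (rule subgroupI)
    show "under b \<subseteq> carrier G" using \<open>under b \<subseteq> H\<close> by auto
    show "under b \<noteq> {}" using \<open>K \<subseteq> under b\<close> K_closed(1) by blast
  next
    fix x assume "x \<in> under b"
    then obtain M where M: "convex M" "b \<notin> M" "x \<in> M"
      unfolding under_def by blast
    then have "inv x \<in> M" using subgroup.m_inv_closed[OF convexD(1)] by blast
    then show "inv x \<in> under b" using subset_under[OF M(1,2)] by blast
  next
    fix x y assume "x \<in> under b" "y \<in> under b"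
    then obtain M where "convex M" "b \<notin> M" "x \<in> M" "y \<in> M"
      unfolding under_def using convex_chain by blast
    then show "x \<otimes> y \<in> under b"
      using subset_under convexD(1) subgroup.m_closed by (metis subsetD)
  qed
next
  fix x m assume "x \<in> P - under b" "m \<in> under b"
  then show "m \<otimes> x \<in> P" unfolding under_def using convexD(4) by blast
qed

lemma under_subset_hull: assumes "b \<in> P" shows "under b \<subseteq> hull_of b"
  using convex_chain[OF convex_under convex_hull] mem_hull not_mem_under assms by blast

lemma mem_hull_of_not_under:
  assumes "a \<in> P" "b \<in> P" "a \<notin> under b" shows "b \<in> hull_of a"
  using subset_under[OF convex_hull[OF assms(1)]] mem_hull[OF assms(1)] assms(3) by blast

text \<open>An element of the jump outside \<open>under b\<close> has a hull containing
  \<open>b\<close>, hence containing \<open>c\<close>, so some power of \<open>a\<close> exceeds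
  \<open>c\<close>. If the difference falls into \<open>under b\<close>, one more factor
  \<open>a\<close> lifts it out.\<close>

lemma jump_archimedean:
  assumes b: "b \<in> P"
    and a: "a \<in> P \<inter> hull_of b - under b" and c: "c \<in> P \<inter> hull_of b - under b"
  shows "\<exists>n::nat. inv c \<otimes> a [^] n \<in> P \<inter> hull_of b - under b"
proof -
  interpret J: cone G "under b" "hull_of b" "P \<inter> hull_of b - under b"
    using cone.cone_convex_quotient[OF cone_restrict[OF convexD(1-3)[OF convex_hull[OF b]]]]
      convex_restrict[OF convex_under[OF b] convexD(1-3)[OF convex_hull[OF b]]] under_subset_hull[OF b]
    by (metis Int_absorb2)
  have "hull_of b \<subseteq> hull_of a"
    using hull_least[OF convex_hull] mem_hull_of_not_under a b by blast
  then obtain n :: nat where n: "inv c \<otimes> a [^] n \<in> P" using c by (auto simp: hull_of_def)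
  have "inv c \<otimes> a [^] n \<in> hull_of b" using a c J.mem_H by simp
  show ?thesis
  proof (cases "inv c \<otimes> a [^] n \<in> under b")
    case True
    have "inv c \<otimes> a [^] Suc n = inv c \<otimes> a [^] n \<otimes> a"
      using a c by (simp add: m_assoc)
    then show ?thesis using J.K_mult_P[OF True a] by metis
  qed (use n \<open>inv c \<otimes> a [^] n \<in> hull_of b\<close> in blast)
qed

end

section \<open>Archimedean cones are abelian\<close>

locale archimedean_cone = cone +
  assumes arch: "a \<in> P \<Longrightarrow> c \<in> P \<Longrightarrow> \<exists>n::nat. inv c \<otimes> a [^] n \<in> P"
begin

text \<open>If b < a, the Archimedean property is applied to b^-1 a, which gives b^-1 a < a^n.
  Otherwise \<open>a\<close> is at most \<open>b\<close>, which is below \<open>b a\<close>.\<close>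

lemma archimedean_conrad: "conrad G P"
  unfolding conrad_def
proof (intro ballI)
  fix a b assume ab: "a \<in> P" "b \<in> P"
  show "\<exists>n::nat. inv a \<otimes> (b \<otimes> a [^] n) \<in> P"
  proof (cases "inv b \<otimes> a \<in> P")
    case True
    then obtain n :: nat where "inv (inv b \<otimes> a) \<otimes> a [^] n \<in> P" using arch ab by blast
    then show ?thesis using ab by (auto simp: inv_mult_group m_assoc)
  next
    case False
    then have "inv a \<otimes> (b \<otimes> a) \<in> P"
      using not_less_mult[of a b "b \<otimes> a"] ab mem_H by simp
    then have "inv a \<otimes> (b \<otimes> a [^] (1::nat)) \<in> P" using ab by simp
    then show ?thesis by blast
  qed
qed

end

sublocale archimedean_cone \<subseteq> conrad_cone
  by unfold_locales (rule archimedean_conrad)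

lemma (in group) conj_pow:
  assumes "g \<in> carrier G" "a \<in> carrier G"
  shows "(inv g \<otimes> (a \<otimes> g)) [^] (n::nat) = inv g \<otimes> (a [^] n \<otimes> g)"
  by (induction n) (use assms in \<open>simp_all add: m_assoc\<close>)

context archimedean_cone
begin

text \<open>Choose \<open>n\<close> with g < a^n. Then (g^-1 a^n) g is a product of positive
  elements and is the \<open>n\<close>-th power of the conjugate, so the conjugate itself is
  positive.\<close>

lemma conj_P_P: assumes g: "g \<in> P" and a: "a \<in> P" shows "inv g \<otimes> (a \<otimes> g) \<in> P"
proof -
  obtain n :: nat where n: "inv g \<otimes> a [^] n \<in> P" using arch a g by blast
  then have "n > 0" using P_inv[OF g] g by (cases "n = 0") auto
  have "inv g \<otimes> a [^] n \<otimes> g \<in> P" using P_mult[OF n g] .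
  then have "(inv g \<otimes> (a \<otimes> g)) [^] n \<in> P" using g a by (simp add: conj_pow m_assoc)
  then show ?thesis using pow_in_P[of "inv g \<otimes> (a \<otimes> g)" n] \<open>n > 0\<close> g a mem_H by simp
qed

text \<open>If a conjugate g^-1 c g with \<open>c\<close> in \<open>K\<close> were positive, some
  power of it would exceed g^2, that is g^2 < g^-1 c^n g. But c^-n g is positive, and
  \<open>conrad_square\<close> for \<open>g\<close> and c^-n g states exactly the opposite. Applying
  this to \<open>k\<close> and to its inverse leaves only \<open>K\<close>.\<close>

lemma conj_K_P: assumes g: "g \<in> P" and k: "k \<in> K" shows "inv g \<otimes> (k \<otimes> g) \<in> K"
proof -
  have *: "inv g \<otimes> (c \<otimes> g) \<notin> P" if c: "c \<in> K" for c
  proof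
    assume x: "inv g \<otimes> (c \<otimes> g) \<in> P"
    obtain n :: nat where "inv (g \<otimes> g) \<otimes> (inv g \<otimes> (c \<otimes> g)) [^] n \<in> P"
      using arch[OF x P_mult[OF g g]] by blast
    then have 1: "inv (g \<otimes> g) \<otimes> (inv g \<otimes> (c [^] n \<otimes> g)) \<in> P"
      using g c by (simp add: conj_pow)
    have "inv (c [^] n) \<otimes> g \<in> P" using g c K_mult_P by simp
    then have "inv g \<otimes> (inv (c [^] n) \<otimes> g \<otimes> (g \<otimes> g)) \<in> P" using conrad_square g by blast
    then show False using P_inv[OF 1] g c by (simp add: inv_mult_group m_assoc)
  qed
  have "inv g \<otimes> (k \<otimes> g) \<in> H" using g k mem_H by simp
  then show ?thesis
  proof (cases rule: P_cases3)
    case neg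
    then show ?thesis using *[of "inv k"] g k by (simp add: inv_mult_group m_assoc)
  qed (use * k in auto)
qed

text \<open>A positive g c g^-1 would be conjugated back to a positive \<open>c\<close> by
  \<open>conj_P_P\<close>.\<close>

lemma conj_K_P': assumes g: "g \<in> P" and k: "k \<in> K" shows "g \<otimes> (k \<otimes> inv g) \<in> K"
proof -
  have *: "g \<otimes> (c \<otimes> inv g) \<notin> P" if c: "c \<in> K" for c
    using conj_P_P[OF g, of "g \<otimes> (c \<otimes> inv g)"] g c P_K[of c] by (auto simp: m_assoc)
  have "g \<otimes> (k \<otimes> inv g) \<in> H" using g k mem_H by simp
  then show ?thesis
  proof (cases rule: P_cases3)
    case neg
    then show ?thesis using *[of "inv k"] g k by (simp add: inv_mult_group m_assoc)
  qed (use * k in auto)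
qed

lemma conj_P_P': assumes g: "g \<in> P" and a: "a \<in> P" shows "g \<otimes> (a \<otimes> inv g) \<in> P"
proof -
  have "g \<otimes> (a \<otimes> inv g) \<in> H" using g a mem_H by simp
  then show ?thesis
  proof (cases rule: P_cases3)
    case neg
    then show ?thesis using conj_P_P[OF g neg] P_inv[OF a] g a by (simp add: inv_mult_group m_assoc)
  next
    case zero
    then show ?thesis using conj_K_P[OF g zero] P_K[OF a] g a by (simp add: m_assoc)
  qed
qed

text \<open>Together with \<open>conj_K\<close> this says that \<open>K\<close> is normal in
  \<open>H\<close> and that the order is invariant on both sides, so inequalities may be multiplied
  on either side in Hoelder's argument below.\<close>

lemma conj_P: assumes g: "g \<in> H" and a: "a \<in> P" shows "inv g \<otimes> (a \<otimes> g) \<in> P"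
  using g
proof (cases rule: P_cases3)
  case neg
  then show ?thesis using conj_P_P'[OF neg a] g a by simp
next
  case zero
  then show ?thesis using K_mult_P P_mult_K a by simp
qed (use conj_P_P a in blast)

lemma conj_K: assumes g: "g \<in> H" and a: "a \<in> K" shows "inv g \<otimes> (a \<otimes> g) \<in> K"
  using g
proof (cases rule: P_cases3)
  case neg
  then show ?thesis using conj_K_P'[OF neg a] g a by simp
next
  case zero
  then show ?thesis using a by simp
qed (use conj_K_P a in blast)

lemma nonneg_mult: "x \<in> P \<union> K \<Longrightarrow> y \<in> P \<union> K \<Longrightarrow> x \<otimes> y \<in> P \<union> K"
  using P_mult K_mult_P P_mult_K by auto

text \<open>The integer part of \<open>x\<close> in the unit \<open>z\<close>: z^m is at most
  \<open>x\<close>, and x < z^(m+1). The least power exceeding \<open>x\<close> has positive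
  exponent because \<open>x\<close> is positive.\<close>

lemma power_floor: assumes z: "z \<in> P" and x: "x \<in> P"
  obtains m :: nat where "inv (z [^] m) \<otimes> x \<in> P \<union> K" "inv x \<otimes> z [^] Suc m \<in> P"
proof -
  define n where "n = (LEAST n::nat. inv x \<otimes> z [^] n \<in> P)"
  have n: "inv x \<otimes> z [^] n \<in> P"
    unfolding n_def using arch[OF z x] by (rule LeastI_ex)
  then have "n \<noteq> 0" using P_inv[OF x] x by (cases "n = 0") auto
  then obtain m where m: "n = Suc m" using not0_implies_Suc by blast
  have "inv x \<otimes> z [^] m \<notin> P"
    using not_less_Least[of m "\<lambda>n. inv x \<otimes> z [^] n \<in> P"] m n_def by simp
  then have "inv (z [^] m) \<otimes> x \<in> P \<union> K"
    using P_cases[of "inv (z [^] m) \<otimes> x"] x z mem_H by (auto simp: inv_mult_group)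
  then show ?thesis using that n m by blast
qed

abbreviation comm :: "'a \<Rightarrow> 'a \<Rightarrow> 'a" where
  "comm x y \<equiv> inv (y \<otimes> x) \<otimes> (x \<otimes> y)"

text \<open>A least positive \<open>z\<close> generates modulo \<open>K\<close>: every positive
  element is a power of \<open>z\<close> times an element of \<open>K\<close>. Powers of
  \<open>z\<close> commute, and conjugation preserves \<open>K\<close>.\<close>

lemma comm_P_discrete:
  assumes z: "z \<in> P" and least: "\<And>w. w \<in> P \<Longrightarrow> inv w \<otimes> z \<notin> P"
    and x: "x \<in> P" and y: "y \<in> P"
  shows "comm x y \<in> K"
proof -
  have *: "\<exists>m::nat. \<exists>k\<in>K. x = z [^] m \<otimes> k" if x: "x \<in> P" for x
  proof -
    obtain m :: nat where m: "inv (z [^] m) \<otimes> x \<in> P \<union> K" "inv x \<otimes> z [^] Suc m \<in> P"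
      using power_floor z x by blast
    \<comment> \<open>The remainder of \<open>x\<close> after division by z^m is below
      \<open>z\<close>, so leastness of \<open>z\<close> excludes that it is positive.\<close>
    have "inv (z [^] m) \<otimes> x \<notin> P"
      using least[of "inv (z [^] m) \<otimes> x"] m(2) x z by (auto simp: inv_mult_group m_assoc)
    then have "inv (z [^] m) \<otimes> x \<in> K" using m by blast
    moreover have "x = z [^] m \<otimes> (inv (z [^] m) \<otimes> x)" using x z by simp
    ultimately show ?thesis by blast
  qed
  obtain m n :: nat and k l where k: "k \<in> K" "x = z [^] m \<otimes> k" and l: "l \<in> K" "y = z [^] n \<otimes> l"
    using *[OF x] *[OF y] by blast
  define u v where "u = z [^] m" and "v = z [^] n"
  have uv: "u \<in> H" "v \<in> H" using z mem_H by (simp_all add: u_def v_def)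
  have "u \<otimes> v = v \<otimes> u" using z by (simp add: u_def v_def nat_pow_comm)
  then have "inv v \<otimes> (u \<otimes> v) \<otimes> inv v = inv v \<otimes> (v \<otimes> u) \<otimes> inv v" by simp
  then have "inv v \<otimes> u = u \<otimes> inv v" using uv by (simp add: m_assoc)
  then have "inv v \<otimes> u \<otimes> (k \<otimes> (v \<otimes> l)) = u \<otimes> inv v \<otimes> (k \<otimes> (v \<otimes> l))" by simp
  then have "inv v \<otimes> (u \<otimes> (k \<otimes> (v \<otimes> l))) = u \<otimes> (inv v \<otimes> (k \<otimes> (v \<otimes> l)))"
    using uv k(1) l(1) by (simp add: m_assoc)
  then have "comm x y = inv k \<otimes> ((inv u \<otimes> (inv l \<otimes> u)) \<otimes> ((inv v \<otimes> (k \<otimes> v)) \<otimes> l))"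
    using uv k l by (simp add: inv_mult_group m_assoc flip: u_def v_def)
  then show ?thesis using conj_K uv k l by simp
qed

text \<open>A positive commutator \<open>c\<close> would admit a positive \<open>z\<close> with z^2
  at most \<open>c\<close>. Approximating \<open>x\<close> and \<open>y\<close> by powers of
  \<open>z\<close> up to one factor each bounds the commutator strictly by z^2.\<close>

lemma comm_P_dense:
  assumes dense: "\<And>z. z \<in> P \<Longrightarrow> \<exists>w\<in>P. inv w \<otimes> z \<in> P"
    and x: "x \<in> P" and y: "y \<in> P"
  shows "comm x y \<notin> P"
proof
  define c where "c = comm x y"
  assume "comm x y \<in> P"
  then have c: "c \<in> P" by (simp add: c_def)
  obtain w where w: "w \<in> P" "inv w \<otimes> c \<in> P" using dense c by blast
  \<comment> \<open>Halving \<open>c\<close>: density gives w < c. If w^2 is at most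
    \<open>c\<close>, take \<open>w\<close>; otherwise take w^-1 c, and conjugate the positive
    element c^-1 w^2 by it. In the last equation the bracket after z^-2 is \<open>c\<close> padded
    with a trivial product.\<close>
  have "\<exists>z\<in>P. inv (z \<otimes> z) \<otimes> c \<in> P \<union> K"
  proof (cases "inv (w \<otimes> w) \<otimes> c \<in> P \<union> K")
    case False
    define z where "z = inv w \<otimes> c"
    have "inv (inv (w \<otimes> w) \<otimes> c) \<in> P"
      using False P_cases[of "inv (w \<otimes> w) \<otimes> c"] w(1) c mem_H by auto
    then have "inv (inv w \<otimes> c) \<otimes> (inv (inv (w \<otimes> w) \<otimes> c) \<otimes> (inv w \<otimes> c)) \<in> P"
      using conj_P[of "inv w \<otimes> c"] w(2) mem_H by blast
    also have "inv (inv w \<otimes> c) \<otimes> (inv (inv (w \<otimes> w) \<otimes> c) \<otimes> (inv w \<otimes> c)) = inv (z \<otimes> z) \<otimes> (inv c \<otimes> (inv z \<otimes> z) \<otimes> c \<otimes> c)"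
      using w(1) c by (simp add: z_def inv_mult_group m_assoc)
    finally show ?thesis using w(2) c by (auto simp: z_def)
  qed (use w in blast)
  then obtain z where z: "z \<in> P" "inv (z \<otimes> z) \<otimes> c \<in> P \<union> K" by blast
  obtain m :: nat where m: "inv (z [^] m) \<otimes> x \<in> P \<union> K" "inv x \<otimes> z [^] Suc m \<in> P"
    using power_floor z x by blast
  obtain n :: nat where n: "inv (z [^] n) \<otimes> y \<in> P \<union> K" "inv y \<otimes> z [^] Suc n \<in> P"
    using power_floor z y by blast
  define u v where "u = z [^] m" and "v = z [^] n"
  have uv: "u \<in> H" "v \<in> H" using z mem_H by (simp_all add: u_def v_def)
  have uvz: "u \<otimes> v = v \<otimes> u" "u \<otimes> z = z \<otimes> u" "v \<otimes> z = z \<otimes> v"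
    using nat_pow_comm[of z m n] nat_pow_comm[of z m 1] nat_pow_comm[of z n 1] z
    by (simp_all add: u_def v_def)
  \<comment> \<open>With \<open>u = z^m\<close> and \<open>v = z^n\<close>, \<open>q\<close> equals
    (v u)^-1 y x and is positive or in \<open>K\<close>, while \<open>r\<close> below equals (x
    y)^-1 v u z^2 and is positive; both are written as products of conjugates of known sign.
    Multiplying \<open>r\<close> by the conjugate of \<open>q\<close> by z^2 cancels everything
    except c^-1 z^2, so c < z^2.\<close>
  define q where "q = (inv u \<otimes> ((inv v \<otimes> y) \<otimes> u)) \<otimes> (inv u \<otimes> x)"
  have "q \<in> P \<union> K"
    unfolding q_def using nonneg_mult conj_P conj_K uv m(1) n(1) by (metis u_def v_def Un_iff)
  then have q: "inv (z \<otimes> z) \<otimes> (q \<otimes> (z \<otimes> z)) \<in> P \<union> K"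
    using conj_P[of "z \<otimes> z"] conj_K[of "z \<otimes> z"] z mem_H by auto
  define r where "r = (inv y \<otimes> ((inv x \<otimes> (u \<otimes> z)) \<otimes> y)) \<otimes> (inv y \<otimes> (v \<otimes> z))"
  have "r \<in> P"
    unfolding r_def using P_mult conj_P y m(2) n(2) mem_H by (simp add: u_def v_def)
  then have "r \<otimes> (inv (z \<otimes> z) \<otimes> (q \<otimes> (z \<otimes> z))) \<in> P"
    using q P_mult P_mult_K by blast
  moreover have "r \<otimes> (inv (z \<otimes> z) \<otimes> (q \<otimes> (z \<otimes> z))) = inv c \<otimes> (z \<otimes> z)"
  proof -
    have "r = inv (x \<otimes> y) \<otimes> (u \<otimes> (z \<otimes> v) \<otimes> z)"
      using x y z uv by (simp add: r_def inv_mult_group m_assoc)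
    also have "u \<otimes> (z \<otimes> v) \<otimes> z = v \<otimes> u \<otimes> (z \<otimes> z)"
      using uv z by (metis uvz m_assoc mem_carrier(1,2) m_closed)
    finally have 1: "r = inv (x \<otimes> y) \<otimes> (v \<otimes> u \<otimes> (z \<otimes> z))" .
    have 2: "q = inv (v \<otimes> u) \<otimes> (y \<otimes> x)"
      using x y uv by (simp add: q_def inv_mult_group m_assoc)
    show ?thesis
      unfolding 1 2 c_def using x y z uv by (simp add: inv_mult_group m_assoc)
  qed
  ultimately have "inv c \<otimes> (z \<otimes> z) \<in> P" by simp
  then have "inv (inv c \<otimes> (z \<otimes> z)) \<notin> P \<union> K"
    using P_inv inv_P_notin_K[of "inv (inv c \<otimes> (z \<otimes> z))"] z c by auto
  then show False using z c by (simp add: inv_mult_group)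
qed

lemma comm_swap: "x \<in> H \<Longrightarrow> y \<in> H \<Longrightarrow> inv (comm x y) = comm y x"
  by (simp add: inv_mult_group m_assoc)

lemma comm_P_P: assumes x: "x \<in> P" and y: "y \<in> P" shows "comm x y \<in> K"
proof (cases "\<exists>z\<in>P. \<forall>w\<in>P. inv w \<otimes> z \<notin> P")
  case False
  then have "comm x y \<notin> P" "comm y x \<notin> P" using comm_P_dense x y by blast+
  then show ?thesis using P_cases[of "comm x y"] comm_swap x y mem_H by auto
qed (use comm_P_discrete assms in blast)

lemma comm_inv_left:
  assumes "x \<in> H" "y \<in> H" "comm x y \<in> K" shows "comm (inv x) y \<in> K"
proof -
  have "comm y x \<in> K" using comm_swap assms by (metis K_closed(3))
  then have "inv (inv x) \<otimes> (comm y x \<otimes> inv x) \<in> K"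
    by (rule conj_K[OF H_closed(3)[OF assms(1)]])
  then show ?thesis using assms by (simp add: inv_mult_group m_assoc)
qed

lemma comm_H_P: assumes x: "x \<in> H" and y: "y \<in> P" shows "comm x y \<in> K"
  using x
proof (cases rule: P_cases3)
  case neg
  then show ?thesis using comm_inv_left[OF _ _ comm_P_P[OF neg y]] x y mem_H by simp
next
  case zero
  then have "inv x \<otimes> (inv y \<otimes> (x \<otimes> y)) \<in> K" using conj_K y mem_H by simp
  then show ?thesis using x y by (simp add: inv_mult_group m_assoc)
qed (use comm_P_P y in blast)

lemma abelian: "abelian_over G K H"
  unfolding abelian_over_def
proof (intro ballI)
  fix x y assume x: "x \<in> H" and y: "y \<in> H"
  have *: "comm y x \<in> K"
    using x
  proof (cases rule: P_cases3)
    case neg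
    have "inv (comm y (inv x)) \<in> K" using comm_H_P[OF y neg] by simp
    then have "comm (inv x) y \<in> K" using comm_swap x y by simp
    then have "comm x y \<in> K" using comm_inv_left[of "inv x" y] x y by simp
    then show ?thesis using comm_swap x y by (metis K_closed(3))
  next
    case zero
    then have "inv y \<otimes> (inv x \<otimes> y) \<otimes> x \<in> K" using conj_K y by simp
    then show ?thesis using x y by (simp add: inv_mult_group m_assoc)
  qed (use comm_H_P y in blast)
  then show "comm x y \<in> K" using comm_swap x y by (metis K_closed(3))
qed

end

context conrad_cone
begin

lemma jump_cone:
  assumes b: "b \<in> P" shows "archimedean_cone G (under b) (hull_of b) (P \<inter> hull_of b - under b)"
proof -
  interpret R: cone G K "hull_of b" "P \<inter> hull_of b"
    using cone_restrict convexD(1-3)[OF convex_hull[OF b]] by blast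
  interpret J: cone G "under b" "hull_of b" "P \<inter> hull_of b - under b"
    using R.cone_convex_quotient convex_restrict[OF convex_under[OF b] convexD(1-3)[OF convex_hull[OF b]]]
      under_subset_hull[OF b] by (metis Int_absorb2)
  show ?thesis by unfold_locales (rule jump_archimedean[OF b])
qed

lemma jump_abelian: "b \<in> P \<Longrightarrow> abelian_over G (under b) (hull_of b)"
  using archimedean_cone.abelian jump_cone by blast

end

section \<open>Orders on torsion-free abelian groups\<close>

text \<open>Modulo \<open>K\<close>, a positive power of \<open>x\<close> is a power of
  \<open>s\<close>. The exponent \<open>k\<close> may be zero or negative, so elements of
  \<open>K\<close> qualify for every \<open>s\<close> and the relation is not symmetric in
  general.\<close>

definition commensurable :: "('a, 'm) monoid_scheme \<Rightarrow> 'a set \<Rightarrow> 'a \<Rightarrow> 'a \<Rightarrow> bool" where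
  "commensurable G K s x \<longleftrightarrow> (\<exists>m::nat. m > 0 \<and> (\<exists>k::int. x [^]\<^bsub>G\<^esub> m \<otimes>\<^bsub>G\<^esub> s [^]\<^bsub>G\<^esub> k \<in> K))"

context comm_group
begin

lemma cone_torsion_free:
  assumes "cone G {\<one>} (carrier G) P" shows "torsion_free G"
  unfolding torsion_free_def
proof (intro ballI allI impI)
  fix x and n :: nat assume "x \<in> carrier G" "0 < n \<and> x [^] n = \<one>"
  then show "x = \<one>" using cone.pow_in_K[OF assms, of x n] by simp
qed

text \<open>A maximal subsemigroup \<open>M\<close> without 1 that contains \<open>S\<close> is a
  cone. If neither \<open>y\<close> nor its inverse lies in \<open>M\<close>, adjoining either one
  produces 1, so \<open>M\<close> contains both a negative and a positive power of \<open>y\<close>,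
  and these multiply to 1.\<close>

lemma extend_cone:
  assumes tf: "torsion_free G" and S: "S \<subseteq> carrier G" "\<one> \<notin> S"
    and S_mult: "\<And>x y. x \<in> S \<Longrightarrow> y \<in> S \<Longrightarrow> x \<otimes> y \<in> S"
  obtains P where "cone G {\<one>} (carrier G) P" "S \<subseteq> P"
proof -
  define A where "A = {M. S \<subseteq> M \<and> M \<subseteq> carrier G \<and> \<one> \<notin> M \<and> (\<forall>x\<in>M. \<forall>y\<in>M. x \<otimes> y \<in> M)}"
  have "\<exists>M\<in>A. \<forall>L\<in>A. M \<subseteq> L \<longrightarrow> L = M"
  proof (rule subset_Zorn_nonempty)
    show "A \<noteq> {}" using S S_mult by (auto simp: A_def)
  next
    fix C assume C: "C \<noteq> {}" "subset.chain A C"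
    have CA: "C \<subseteq> A" using C(2) by (simp add: subset.chain_def)
    have "x \<otimes> y \<in> \<Union>C" if xy: "x \<in> \<Union>C" "y \<in> \<Union>C" for x y
    proof -
      obtain M N where "M \<in> C" "x \<in> M" "N \<in> C" "y \<in> N" using xy by blast
      moreover have "M \<subseteq> N \<or> N \<subseteq> M"
        using C(2) \<open>M \<in> C\<close> \<open>N \<in> C\<close> by (auto simp: subset_chain_def)
      ultimately obtain L where "L \<in> C" "x \<in> L" "y \<in> L" by blast
      then show ?thesis using CA by (auto simp: A_def)
    qed
    moreover have "S \<subseteq> \<Union>C" using C(1) CA unfolding A_def by blast
    moreover have "\<Union>C \<subseteq> carrier G" "\<one> \<notin> \<Union>C" using CA by (auto simp: A_def)
    ultimately show "\<Union>C \<in> A" by (simp add: A_def)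
  qed
  then obtain M where "M \<in> A" and M_max: "\<And>L. L \<in> A \<Longrightarrow> M \<subseteq> L \<Longrightarrow> L = M"
    by blast
  then have M: "S \<subseteq> M" "M \<subseteq> carrier G" "\<one> \<notin> M" "\<And>x y. x \<in> M \<Longrightarrow> y \<in> M \<Longrightarrow> x \<otimes> y \<in> M"
    by (simp_all add: A_def)
  have Mc: "x \<in> carrier G" if "x \<in> M" for x using M(2) that by blast
  have M_pow: "x [^] n \<in> M" if "x \<in> M" "n > 0" for x and n :: nat
    using that(2)
  proof (induction n)
    case (Suc n)
    then show ?case using M(4) that(1) Mc[OF that(1)] by (cases "n = 0") auto
  qed simp
  have key: "\<exists>n::nat. n > 0 \<and> inv (y [^] n) \<in> M" if y: "y \<in> carrier G" "y \<noteq> \<one>" "y \<notin> M" for y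
  proof -
    \<comment> \<open>The semigroup generated by \<open>M\<close> and \<open>y\<close>. By
      maximality it contains 1, and torsion-freeness makes the factor from \<open>M\<close> in that
      relation nontrivial.\<close>
    define N where "N = M \<union> {m \<otimes> y [^] n | m n. m \<in> insert \<one> M \<and> n > (0::nat)}"
    have N_mult: "a \<otimes> b \<in> N" if ab: "a \<in> N" "b \<in> N" for a b
    proof -
      have *: "\<exists>m\<in>insert \<one> M. \<exists>n::nat. a = m \<otimes> y [^] n \<and> (n = 0 \<longrightarrow> m \<in> M)" if "a \<in> N" for a
        using that y M(2) Mc unfolding N_def
        by (smt (verit, ccfv_SIG) Un_iff insertI2 less_numeral_extra(3) mem_Collect_eq nat_pow_0 r_one)
      obtain m n m' n' where mn: "m \<in> insert \<one> M" "a = m \<otimes> y [^] (n::nat)" "n = 0 \<longrightarrow> m \<in> M"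
        "m' \<in> insert \<one> M" "b = m' \<otimes> y [^] (n'::nat)" "n' = 0 \<longrightarrow> m' \<in> M"
        using *[OF ab(1)] *[OF ab(2)] by blast
      have c: "m \<in> carrier G" "m' \<in> carrier G" using mn Mc by auto
      have eq: "a \<otimes> b = (m \<otimes> m') \<otimes> y [^] (n + n')"
        using mn c y by (simp add: m_ac nat_pow_mult[symmetric])
      have mm: "m \<otimes> m' \<in> insert \<one> M" using mn M(4) Mc by auto
      show ?thesis
      proof (cases "n + n' = 0")
        case True
        then have "a \<otimes> b \<in> M" using eq mn M(4) c by auto
        then show ?thesis by (simp add: N_def)
      next
        case False
        then show ?thesis using eq mm unfolding N_def by blast
      qed
    qed
    have "y \<in> N" unfolding N_def using y(1) by (auto intro!: exI[of _ \<one>] exI[of _ "1::nat"])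
    have Nc: "N \<subseteq> carrier G" using y(1) M(2) by (auto simp: N_def)
    have "N \<notin> A"
    proof
      assume "N \<in> A"
      then have "N = M" using M_max by (simp add: N_def)
      then show False using \<open>y \<in> N\<close> y(3) by simp
    qed
    moreover have "S \<subseteq> N" using M(1) by (auto simp: N_def)
    ultimately have "\<one> \<in> N" using Nc N_mult unfolding A_def by blast
    then obtain m n where mn: "m \<in> insert \<one> M" "n > (0::nat)" "m \<otimes> y [^] n = \<one>"
      using M(3) unfolding N_def Un_iff mem_Collect_eq by metis
    have "m \<noteq> \<one>"
    proof
      assume "m = \<one>"
      then have "y [^] n = \<one>" using mn(3) y(1) by simp
      then show False using tf y mn(2) unfolding torsion_free_def by blast
    qed
    then have "m \<in> M" using mn(1) by simp
    moreover have "m = inv (y [^] n)"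
      using inv_equality[of m "y [^] n"] mn(3) y(1) Mc[OF \<open>m \<in> M\<close>] by simp
    ultimately show ?thesis using mn(2) by blast
  qed
  have "cone G {\<one>} (carrier G) M"
  proof (rule coneI)
    fix y assume y: "y \<in> carrier G"
    show "y \<in> M \<or> inv y \<in> M \<or> y \<in> {\<one>}"
    proof (rule ccontr)
      assume neg: "\<not> ?thesis"
      then obtain n :: nat where n: "n > 0" "inv (y [^] n) \<in> M" using key[of y] y by blast
      obtain k :: nat where k: "k > 0" "inv (inv y [^] k) \<in> M" using key[of "inv y"] y neg by auto
      have "inv (y [^] n) [^] k \<otimes> inv (inv y [^] k) [^] n \<in> M"
        using n k M_pow M(4) by blast
      moreover have "inv (y [^] n) [^] k \<otimes> inv (inv y [^] k) [^] n = \<one>"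
        using y by (simp add: nat_pow_inv nat_pow_pow mult.commute)
      ultimately show False using M(3) by simp
    qed
  next
    fix y assume y: "y \<in> M"
    then have "y \<otimes> inv y = \<one>" using Mc by simp
    then show "inv y \<notin> M" using M(3) M(4)[OF y, of "inv y"] by auto
  qed (use M triv_subgroup subgroup_self in auto)
  then show ?thesis using that M(1) by blast
qed

section \<open>Orders on abelian groups determined by finitely many positive elements\<close>

inductive_set mon :: "'a set \<Rightarrow> 'a set" for F where
  one: "\<one> \<in> mon F"
| step: "f \<in> F \<Longrightarrow> w \<in> mon F \<Longrightarrow> f \<otimes> w \<in> mon F"

lemma mon_carrier: assumes "F \<subseteq> carrier G" shows "w \<in> mon F \<Longrightarrow> w \<in> carrier G"
  by (induction rule: mon.induct) (use assms in auto)

lemma mon_mult: assumes "F \<subseteq> carrier G" "v \<in> mon F" shows "w \<in> mon F \<Longrightarrow> w \<otimes> v \<in> mon F"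
proof (induction rule: mon.induct)
  case (step f w)
  then show ?case using mon.step[of f F "w \<otimes> v"] assms mon_carrier[OF assms(1)] by (auto simp: m_assoc)
qed (use assms mon_carrier in auto)

lemma mon_pow: "F \<subseteq> carrier G \<Longrightarrow> w \<in> mon F \<Longrightarrow> w [^] (n::nat) \<in> mon F"
  by (induction n) (auto intro: mon.one mon_mult)

lemma mon_incl: "F \<subseteq> carrier G \<Longrightarrow> f \<in> F \<Longrightarrow> f \<in> mon F"
  using mon.step[OF _ mon.one, of f F] by auto

lemma mon_remove:
  assumes "F \<subseteq> carrier G" "f \<in> F"
  shows "w \<in> mon F \<Longrightarrow> \<exists>i::nat. \<exists>v\<in>mon (F - {f}). w = f [^] i \<otimes> v"
proof (induction rule: mon.induct)
  case one
  have "\<one> = f [^] (0::nat) \<otimes> \<one>" by simp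
  then show ?case using mon.one by blast
next
  case (step g w)
  then obtain i :: nat and v where v: "v \<in> mon (F - {f})" "w = f [^] i \<otimes> v" by blast
  have c: "f \<in> carrier G" "g \<in> carrier G" "v \<in> carrier G"
    using assms step v mon_carrier[of "F - {f}" v] by auto
  show ?case
  proof (cases "g = f")
    case True
    then have "g \<otimes> w = f [^] Suc i \<otimes> v" using v c by (simp add: m_ac)
    then show ?thesis using v by blast
  next
    case False
    then have "g \<otimes> v \<in> mon (F - {f})" using step v by (auto intro: mon.step)
    moreover have "g \<otimes> w = f [^] i \<otimes> (g \<otimes> v)" using v c by (simp add: m_ac)
    ultimately show ?thesis by blast
  qed
qed

lemma mon_cone:
  assumes "cone G {\<one>} (carrier G) P" "F \<subseteq> P" shows "w \<in> mon F \<Longrightarrow> w \<in> insert \<one> P"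
proof (induction rule: mon.induct)
  case (step f w)
  interpret cone G "{\<one>}" "carrier G" P by fact
  show ?case using step assms P_mult by auto
qed simp

text \<open>If no positive power of \<open>x\<close> is a product of elements of \<open>F\<close>,
  the elements w x^-n with \<open>w\<close> in \<open>mon F\<close> form a semigroup that avoids 1.
  It contains \<open>F\<close> and the inverse of \<open>x\<close>, and any order extending it
  contradicts uniqueness.\<close>

lemma unique_cone_spanned:
  assumes "cone G {\<one>} (carrier G) P" and F: "F \<subseteq> P"
    and unique: "\<And>Q. cone G {\<one>} (carrier G) Q \<Longrightarrow> F \<subseteq> Q \<Longrightarrow> Q = P"
    and x: "x \<in> P"
  shows "\<exists>n::nat. n > 0 \<and> x [^] n \<in> mon F"
proof (rule ccontr)
  assume neg: "\<not> ?thesis"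
  interpret C: cone G "{\<one>}" "carrier G" P by fact
  have Fc: "F \<subseteq> carrier G" using F by auto
  have xc: "x \<in> carrier G" using x by simp
  have tf: "torsion_free G" using assms(1) by (rule cone_torsion_free)
  \<comment> \<open>The side condition removes only the trivial expression with \<open>w = 1\<close>
    and \<open>n = 0\<close>.\<close>
  define S where "S = {w \<otimes> inv x [^] n | w n. w \<in> mon F \<and> (w \<noteq> \<one> \<or> n > (0::nat))}"
  have Sc: "S \<subseteq> carrier G" using mon_carrier[OF Fc] xc by (auto simp: S_def)
  have "\<one> \<notin> S"
  proof
    assume "\<one> \<in> S"
    then obtain w n where w: "w \<in> mon F" "w \<noteq> \<one> \<or> n > (0::nat)" "w \<otimes> inv x [^] n = \<one>"
      unfolding S_def mem_Collect_eq by metis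
    then have "w = inv (inv x [^] n)"
      using inv_equality[of w "inv x [^] n"] mon_carrier[OF Fc] xc by simp
    then have "w = x [^] n" using xc by (simp add: nat_pow_inv)
    then show False using w neg by (metis gr0I nat_pow_0)
  qed
  moreover have "a \<otimes> b \<in> S" if "a \<in> S" "b \<in> S" for a b
  proof -
    obtain w n where w: "w \<in> mon F" "w \<noteq> \<one> \<or> n > (0::nat)" "a = w \<otimes> inv x [^] n"
      using \<open>a \<in> S\<close> unfolding S_def by blast
    obtain v k where v: "v \<in> mon F" "v \<noteq> \<one> \<or> k > (0::nat)" "b = v \<otimes> inv x [^] k"
      using \<open>b \<in> S\<close> unfolding S_def by blast
    have "a \<otimes> b = (w \<otimes> v) \<otimes> inv x [^] (n + k)"
      using w v xc mon_carrier[OF Fc] by (simp add: m_ac nat_pow_mult[symmetric])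
    moreover have "w \<otimes> v \<in> mon F" using mon_mult[OF Fc] w v by blast
    moreover have "w \<otimes> v \<noteq> \<one> \<or> n + k > 0"
    proof (rule ccontr)
      assume "\<not> ?thesis"
      then have "w \<in> P" "v \<in> P" "w \<otimes> v = \<one>"
        using w v mon_cone[OF assms(1) F] by auto
      then show False using C.P_mult C.one_notin_P by metis
    qed
    ultimately show ?thesis unfolding S_def by blast
  qed
  ultimately obtain Q where Q: "cone G {\<one>} (carrier G) Q" "S \<subseteq> Q"
    using extend_cone[OF tf Sc] by blast
  have "F \<subseteq> S"
  proof
    fix f assume f: "f \<in> F"
    then have "f \<in> mon F" "f \<noteq> \<one>" "f = f \<otimes> inv x [^] (0::nat)"
      using mon_incl[OF Fc] F C.one_notin_P by auto
    then show "f \<in> S" unfolding S_def by blast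
  qed
  then have "Q = P" using unique Q by blast
  moreover have "inv x = \<one> \<otimes> inv x [^] (1::nat)" using xc by simp
  then have "inv x \<in> S" unfolding S_def mem_Collect_eq using mon.one zero_less_one by blast
  ultimately show False using Q(2) C.P_inv x by blast
qed

lemma spanned_redundant:
  assumes "cone G {\<one>} (carrier G) P" and F: "F \<subseteq> P"
    and span: "\<And>x. x \<in> P \<Longrightarrow> \<exists>n::nat. n > 0 \<and> x [^] n \<in> mon F"
    and fg: "f \<in> F" "g \<in> F" "f \<noteq> g" "inv g \<otimes> f \<in> P" and x: "x \<in> P"
  shows "\<exists>n::nat. n > 0 \<and> x [^] n \<in> mon (F - {f})"
proof -
  interpret C: cone G "{\<one>}" "carrier G" P by fact
  have Fc: "F \<subseteq> carrier G" "F - {f} \<subseteq> carrier G" and FP: "F - {f} \<subseteq> P" using F by auto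
  have fgP: "f \<in> P" "g \<in> P" using fg F by auto
  obtain n :: nat where n: "n > 0" "(inv g \<otimes> f) [^] n \<in> mon F" using span fg(4) by blast
  obtain i :: nat and v where v: "v \<in> mon (F - {f})" "(inv g \<otimes> f) [^] n = f [^] i \<otimes> v"
    using mon_remove[OF Fc(1) fg(1) n(2)] by blast
  define u where "u = g [^] n \<otimes> v"
  have vc: "v \<in> carrier G" using v mon_carrier Fc by blast
  have u: "u \<in> mon (F - {f})"
    unfolding u_def using mon_mult[OF Fc(2) v(1)] mon_pow[OF Fc(2) mon_incl[OF Fc(2)]] fg by auto
  have uP: "u \<in> P"
    unfolding u_def using mon_cone[OF assms(1) FP v(1)] C.P_pow[OF fgP(2) n(1)] C.P_mult by auto
  have "f [^] n = g [^] n \<otimes> (inv g \<otimes> f) [^] n"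
    using fgP by (simp add: nat_pow_distrib nat_pow_inv)
  then have fn: "f [^] n = f [^] i \<otimes> u"
    using v(2) vc fgP by (simp add: u_def m_ac)
  \<comment> \<open>For \<open>i\<close> at least \<open>n\<close>, cancelling f^n would make the
    positive element f^(i-n) u trivial.\<close>
  have "i < n"
  proof (rule ccontr)
    assume "\<not> i < n"
    then have "f [^] i = f [^] n \<otimes> f [^] (i - n)" using fgP by (simp add: nat_pow_mult)
    then have "f [^] n = f [^] n \<otimes> f [^] (i - n) \<otimes> u" using fn by argo
    then have "f [^] n = f [^] n \<otimes> (f [^] (i - n) \<otimes> u)"
      using m_assoc[of "f [^] n" "f [^] (i - n)" u] fgP uP by force
    moreover have "f [^] n \<in> carrier G" "f [^] (i - n) \<otimes> u \<in> carrier G" using fgP uP by simp_all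
    ultimately have "f [^] (i - n) \<otimes> u = \<one>" using l_cancel_one' by blast
    then show False using C.P_pow_mult[OF fgP(1) uP, of "i - n"] C.one_notin_P by argo
  qed
  define d where "d = n - i"
  have "f [^] n = f [^] i \<otimes> f [^] d" using \<open>i < n\<close> fgP by (simp add: d_def nat_pow_mult)
  then have fd: "f [^] d = u" using fn fgP uP by simp
  obtain m :: nat where m: "m > 0" "x [^] m \<in> mon F" using span x by blast
  obtain j :: nat and w where w: "w \<in> mon (F - {f})" "x [^] m = f [^] j \<otimes> w"
    using mon_remove[OF Fc(1) fg(1) m(2)] by blast
  have wc: "w \<in> carrier G" using w mon_carrier Fc by blast
  have "x [^] (m * d) = (f [^] j \<otimes> w) [^] d" using w(2) x by (simp add: nat_pow_pow[symmetric])
  also have "\<dots> = (f [^] d) [^] j \<otimes> w [^] d"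
    using fgP wc by (simp add: nat_pow_distrib nat_pow_pow mult.commute)
  also have "\<dots> \<in> mon (F - {f})"
    unfolding fd using mon_mult[OF Fc(2)] mon_pow[OF Fc(2)] u w by blast
  finally show ?thesis using m(1) \<open>i < n\<close> by (auto simp: d_def intro!: exI[of _ "m * (n - i)"])
qed

lemma spanned_rank_one:
  assumes "cone G {\<one>} (carrier G) P" "P \<noteq> {}"
  shows "\<lbrakk>finite F; F \<subseteq> P; \<And>x. x \<in> P \<Longrightarrow> \<exists>n::nat. n > 0 \<and> x [^] n \<in> mon F\<rbrakk>
    \<Longrightarrow> \<exists>s\<in>F. \<forall>x\<in>P. \<exists>n::nat. n > 0 \<and> (\<exists>i::nat. x [^] n = s [^] i)"
proof (induction "card F" arbitrary: F rule: less_induct)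
  case less
  interpret C: cone G "{\<one>}" "carrier G" P by fact
  have Fc: "F \<subseteq> carrier G" using less by auto
  show ?case
  proof (cases "\<exists>f\<in>F. \<exists>g\<in>F. f \<noteq> g")
    case True
    then obtain f g where fg: "f \<in> F" "g \<in> F" "f \<noteq> g" by blast
    have fgc: "f \<in> carrier G" "g \<in> carrier G" using fg less by auto
    then have "inv g \<otimes> f \<noteq> \<one>"
      using fg(3) inv_comm inv_equality by (metis inv_inv inv_closed)
    \<comment> \<open>The order is total, so one of any two distinct elements of \<open>F\<close> is
      the larger and can be removed.\<close>
    then have "inv g \<otimes> f \<in> P \<or> inv f \<otimes> g \<in> P"
      using C.P_cases[of "inv g \<otimes> f"] fgc by (auto simp: inv_mult_group)
    then obtain f where f: "f \<in> F" "\<And>x. x \<in> P \<Longrightarrow> \<exists>n::nat. n > 0 \<and> x [^] n \<in> mon (F - {f})"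
      using spanned_redundant[OF assms(1) less(3,4)] fg by metis
    have "card (F - {f}) < card F" using f less(2) by (meson card_Diff1_less)
    then have "\<exists>s\<in>F - {f}. \<forall>x\<in>P. \<exists>n::nat. n > 0 \<and> (\<exists>i::nat. x [^] n = s [^] i)"
      using less(1)[of "F - {f}"] less(2,3) f(2) by blast
    then show ?thesis by blast
  next
    case False
    have mon_empty: "w = \<one>" if "w \<in> mon {}" for w
      using that by (cases rule: mon.cases) auto
    obtain x where x: "x \<in> P" using assms(2) by blast
    have "F \<noteq> {}"
    proof
      assume "F = {}"
      then obtain n :: nat where "n > 0" "x [^] n = \<one>" using less(4)[OF x] mon_empty by blast
      then show False using C.P_pow[OF x] C.one_notin_P by metis
    qed
    then obtain s where s: "F = {s}" using False by blast
    have "\<exists>n::nat. n > 0 \<and> (\<exists>i::nat. y [^] n = s [^] i)" if y: "y \<in> P" for y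
    proof -
      obtain n :: nat where n: "n > 0" "y [^] n \<in> mon F" using less(4)[OF y] by blast
      obtain i :: nat and v where "v \<in> mon (F - {s})" "y [^] n = s [^] i \<otimes> v"
        using mon_remove[OF Fc _ n(2), of s] s by blast
      then have "y [^] n = s [^] i" using mon_empty s Fc by auto
      then show ?thesis using n by blast
    qed
    then show ?thesis using s by blast
  qed
qed

lemma unique_cone_rank_one:
  assumes "cone G {\<one>} (carrier G) P" "P \<noteq> {}" and F: "finite F" "F \<subseteq> P"
    and unique: "\<And>Q. cone G {\<one>} (carrier G) Q \<Longrightarrow> F \<subseteq> Q \<Longrightarrow> Q = P"
  shows "\<exists>s\<in>F. \<forall>x\<in>carrier G. commensurable G {\<one>} s x"
proof -
  interpret C: cone G "{\<one>}" "carrier G" P by fact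
  obtain s where s: "s \<in> F" "\<And>x. x \<in> P \<Longrightarrow> \<exists>n::nat. n > 0 \<and> (\<exists>i::nat. x [^] n = s [^] i)"
    using spanned_rank_one[OF assms(1,2) F unique_cone_spanned[OF assms(1) F(2) unique]] by blast
  have sc: "s \<in> carrier G" using s F by auto
  have "commensurable G {\<one>} s x" if x: "x \<in> carrier G" for x
    using x
  proof (cases rule: C.P_cases3)
    case pos
    then obtain n i :: nat where n: "n > 0" "x [^] n = s [^] i" using s(2) by blast
    then have "x [^] n \<otimes> s [^] (- int i) = \<one>" using sc by (simp add: int_pow_neg_int)
    then show ?thesis unfolding commensurable_def using n by blast
  next
    case neg
    then obtain n i :: nat where n: "n > 0" "inv x [^] n = s [^] i" using s(2) by blast
    then have "x [^] n \<otimes> s [^] (int i) = \<one>" using sc x by (simp add: int_pow_int nat_pow_inv flip: n(2))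
    then show ?thesis unfolding commensurable_def using n by blast
  next
    case zero
    then have "x [^] (1::nat) \<otimes> s [^] (0::int) = \<one>" by simp
    then show ?thesis unfolding commensurable_def by (metis insertI1 zero_less_one)
  qed
  then show ?thesis using s(1) by blast
qed

section \<open>Rank one and the order it carries\<close>

lemma torsion_free_int_pow:
  assumes "torsion_free G" "s \<in> carrier G" "s [^] (k::int) = \<one>" "s \<noteq> \<one>" shows "k = 0"
proof (rule ccontr)
  assume "k \<noteq> 0"
  have "s [^] nat \<bar>k\<bar> = \<one>"
    using assms(2,3) int_pow_neg[OF assms(2), of k] pow_nat[of "\<bar>k\<bar>" G s] by (cases "k \<ge> 0") auto
  then show False using assms(1,2,4) \<open>k \<noteq> 0\<close> unfolding torsion_free_def by (metis zero_less_abs_iff zero_less_nat_eq)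
qed

lemma commensurable_int:
  assumes "s \<in> carrier G" "x \<in> carrier G" "m \<noteq> 0" "x [^] (m::int) \<otimes> s [^] (k::int) = \<one>"
  shows "commensurable G {\<one>} s x"
proof (cases "m > 0")
  case True
  then have "x [^] nat m \<otimes> s [^] k \<in> {\<one>}" using assms(4) by (simp add: pow_nat)
  then show ?thesis unfolding commensurable_def using True zero_less_nat_eq by blast
next
  case False
  have "x [^] nat (- m) \<otimes> s [^] (- k) = inv (x [^] m \<otimes> s [^] k)"
    using assms(1,2) False by (simp add: pow_nat int_pow_neg inv_mult)
  then have "x [^] nat (- m) \<otimes> s [^] (- k) \<in> {\<one>}" using assms(4) by simp
  moreover have "nat (- m) > 0" using False assms(3) by simp
  ultimately show ?thesis unfolding commensurable_def by blast
qed

lemma commensurableE: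
  assumes "commensurable G {\<one>} s x" "s \<in> carrier G" "x \<in> carrier G"
  obtains m k :: int where "m > 0" "x [^] m = s [^] k"
proof -
  obtain m :: nat and k :: int where mk: "m > 0" "x [^] m \<otimes> s [^] k = \<one>"
    using assms(1) by (auto simp: commensurable_def)
  then have "x [^] int m = s [^] (- k)"
    using assms(2,3) inv_equality[of "x [^] m" "s [^] k"] by (simp add: int_pow_int int_pow_neg)
  then show ?thesis using that[of "int m" "- k"] mk by simp
qed

text \<open>From g^a = s^i and x^b = s^j follows x^(b i) = g^(a j). The exponent \<open>b i\<close>
  is nonzero because \<open>g\<close> has infinite order. Hence any nontrivial element can serve as
  the reference element.\<close>

lemma commensurable_trans:
  assumes tf: "torsion_free G" and s: "s \<in> carrier G"
    and g: "g \<in> carrier G" "g \<noteq> \<one>" "commensurable G {\<one>} s g"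
    and x: "x \<in> carrier G" "commensurable G {\<one>} s x"
  shows "commensurable G {\<one>} g x"
proof -
  obtain a i :: int where a: "a > 0" "g [^] a = s [^] i" using commensurableE g s by metis
  obtain b j :: int where b: "b > 0" "x [^] b = s [^] j" using commensurableE x s by metis
  have "i \<noteq> 0" using torsion_free_int_pow[OF tf g(1) _ g(2), of a] a by auto
  have "x [^] (b * i) = (s [^] i) [^] j"
    using x(1) s b(2) by (simp add: int_pow_pow[symmetric]) (simp add: int_pow_pow mult.commute)
  then have "x [^] (b * i) = g [^] (a * j)" using g(1) by (simp add: int_pow_pow flip: a(2))
  then have "x [^] (b * i) \<otimes> g [^] (- (a * j)) = \<one>" using g(1) x(1) by (simp add: int_pow_neg)
  from commensurable_int[OF g(1) x(1) _ this] show ?thesis using b(1) \<open>i \<noteq> 0\<close> by simp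
qed

text \<open>In a torsion-free group a nontrivial \<open>s\<close> is independent by itself, and
  \<open>{s}\<close> is maximal exactly when every \<open>x\<close> satisfies a relation with
  \<open>s\<close> in which the exponent of \<open>x\<close> is nonzero.\<close>

lemma has_rank_one_iff:
  assumes tf: "torsion_free G"
  shows "has_rank G 1 \<longleftrightarrow> (\<exists>s\<in>carrier G - {\<one>}. \<forall>x\<in>carrier G. commensurable G {\<one>} s x)"
proof
  assume "has_rank G 1"
  then obtain S where S: "int_independent G S" "\<And>T. int_independent G T \<Longrightarrow> S \<subseteq> T \<Longrightarrow> T = S" "card S = 1"
    unfolding has_rank_def by blast
  then obtain s where s: "S = {s}" by (auto simp: card_1_singleton_iff)
  have sc: "s \<in> carrier G" using S(1) s by (simp add: int_independent_def)
  have "s \<noteq> \<one>"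
  proof
    assume "s = \<one>"
    then have "(\<Otimes>x\<in>{s}. x [^] (1::int)) = \<one>" by simp
    moreover have "finite F \<and> F \<subseteq> S \<and> (\<Otimes>x\<in>F. x [^] c x) = \<one> \<longrightarrow> (\<forall>x\<in>F. c x = 0)"
      for F and c :: "'a \<Rightarrow> int"
      using S(1) unfolding int_independent_def by blast
    from this[of "{s}" "\<lambda>_. 1"] have "(\<Otimes>x\<in>{s}. x [^] (1::int)) \<noteq> \<one>" using s by simp
    ultimately show False by simp
  qed
  moreover have "commensurable G {\<one>} s x" if x: "x \<in> carrier G" for x
  proof (cases "x = s")
    case True
    then have "x [^] (1::int) \<otimes> s [^] (- 1::int) = \<one>" using x by (simp add: int_pow_neg)
    then show ?thesis using commensurable_int[OF sc x, of 1] by simp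
  next
    case False
    then have "\<not> int_independent G {s, x}" using S(2)[of "{s, x}"] s by auto
    then obtain F and c :: "'a \<Rightarrow> int" where F: "F \<subseteq> {s, x}" "(\<Otimes>y\<in>F. y [^] c y) = \<one>" "\<exists>y\<in>F. c y \<noteq> 0"
      unfolding int_independent_def using sc x by blast
    \<comment> \<open>The dependency may involve only part of \<open>{s, x}\<close>; extending its
      exponents by 0 gives one relation between \<open>s\<close> and \<open>x\<close>.\<close>
    define d where "d = (\<lambda>y. if y \<in> F then c y else 0)"
    have "(\<Otimes>y\<in>{s, x}. y [^] d y) = (\<Otimes>y\<in>F. y [^] c y)"
      using F(1) sc x by (intro finprod_mono_neutral_cong_right) (auto simp: d_def)
    moreover have "(\<Otimes>y\<in>{s, x}. y [^] d y) = s [^] d s \<otimes> x [^] d x" using False sc x by simp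
    ultimately have eq: "s [^] d s \<otimes> x [^] d x = \<one>" using F(2) by metis
    obtain y where "y \<in> F" "c y \<noteq> 0" using F(3) by blast
    then have "d y \<noteq> 0" "y = s \<or> y = x" using F(1) by (auto simp: d_def)
    then have "d s \<noteq> 0 \<or> d x \<noteq> 0" by blast
    moreover have "d s = 0" if "d x = 0"
      using torsion_free_int_pow[OF tf sc _ \<open>s \<noteq> \<one>\<close>] eq that sc by simp
    ultimately have "d x \<noteq> 0" by blast
    then show ?thesis using commensurable_int[OF sc x _, of "d x" "d s"] eq sc x by (simp add: m_comm)
  qed
  ultimately show "\<exists>s\<in>carrier G - {\<one>}. \<forall>x\<in>carrier G. commensurable G {\<one>} s x" using sc by blast
next
  assume "\<exists>s\<in>carrier G - {\<one>}. \<forall>x\<in>carrier G. commensurable G {\<one>} s x"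
  then obtain s where s: "s \<in> carrier G" "s \<noteq> \<one>" "\<And>x. x \<in> carrier G \<Longrightarrow> commensurable G {\<one>} s x" by blast
  have "int_independent G {s}"
    unfolding int_independent_def
  proof (intro conjI allI impI)
    fix F and c :: "'a \<Rightarrow> int" assume F: "finite F \<and> F \<subseteq> {s} \<and> (\<Otimes>x\<in>F. x [^] c x) = \<one>"
    show "\<forall>x\<in>F. c x = 0"
    proof (cases "F = {}")
      case False
      then have "F = {s}" using F by blast
      then have "s [^] c s = \<one>" using F s(1) by simp
      then show ?thesis using torsion_free_int_pow[OF tf s(1) _ s(2)] \<open>F = {s}\<close> by simp
    qed simp
  qed (use s in simp)
  moreover have "T = {s}" if T: "int_independent G T" "{s} \<subseteq> T" for T
  proof (rule ccontr)
    assume "T \<noteq> {s}"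
    then obtain t where t: "t \<in> T" "t \<noteq> s" using T(2) by blast
    then have tc: "t \<in> carrier G" using T(1) by (auto simp: int_independent_def)
    obtain m k :: int where mk: "m > 0" "t [^] m = s [^] k" using commensurableE[OF s(3)[OF tc] s(1) tc] by blast
    define c where "c = (\<lambda>y. if y = t then m else - k)"
    have "(\<Otimes>y\<in>{s, t}. y [^] c y) = \<one>"
      using t(2) s(1) tc mk(2) by (simp add: c_def int_pow_neg)
    moreover have "finite F \<and> F \<subseteq> T \<and> (\<Otimes>x\<in>F. x [^] c x) = \<one> \<longrightarrow> (\<forall>x\<in>F. c x = 0)" for F
      using T(1) unfolding int_independent_def by blast
    from this[of "{s, t}"] have "(\<Otimes>y\<in>{s, t}. y [^] c y) = \<one> \<longrightarrow> c t = 0" using T(2) t(1) by blast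
    ultimately have "c t = 0" by blast
    then show False using mk(1) by (simp add: c_def)
  qed
  moreover have "finite {s}" "card {s} = 1" by simp_all
  ultimately show "has_rank G 1" unfolding has_rank_def by blast
qed

text \<open>Up to positive powers every element is a power of \<open>s\<close>, and the sign of that
  exponent defines the order, as for a subgroup of the rationals containing \<open>s\<close> as a
  positive number.\<close>

lemma rank_one_cone:
  assumes tf: "torsion_free G" and s: "s \<in> carrier G" "s \<noteq> \<one>"
    and comm: "\<And>x. x \<in> carrier G \<Longrightarrow> commensurable G {\<one>} s x"
  shows "cone G {\<one>} (carrier G) {x \<in> carrier G. \<exists>m>0. \<exists>k>0. x [^] (m::int) = s [^] (k::int)}"
    (is "cone G _ _ ?P")
proof (rule coneI)
  fix x y assume "x \<in> ?P" "y \<in> ?P"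
  then obtain m k n l :: int where x: "x \<in> carrier G" "m > 0" "k > 0" "x [^] m = s [^] k"
    and y: "y \<in> carrier G" "n > 0" "l > 0" "y [^] n = s [^] l" by blast
  have "(x \<otimes> y) [^] (m * n) = (x [^] m) [^] n \<otimes> (y [^] n) [^] m"
    using x(1) y(1) by (simp add: int_pow_distrib int_pow_pow mult.commute)
  also have "\<dots> = s [^] (k * n + l * m)" using s(1) x y by (simp add: int_pow_pow int_pow_mult)
  finally have "(x \<otimes> y) [^] (m * n) = s [^] (k * n + l * m)" .
  moreover have "m * n > 0" "k * n + l * m > 0" using x y by (simp_all add: add_pos_pos)
  ultimately show "x \<otimes> y \<in> ?P" using x(1) y(1) by blast
next
  fix x assume x: "x \<in> carrier G"
  obtain m k :: int where mk: "m > 0" "x [^] m = s [^] k" using commensurableE[OF comm[OF x] s(1) x] by blast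
  consider "k > 0" | "k < 0" | "k = 0" by linarith
  then show "x \<in> ?P \<or> inv x \<in> ?P \<or> x \<in> {\<one>}"
  proof cases
    case 2
    have "inv x [^] m = s [^] (- k)" using x s mk by (simp add: int_pow_inv int_pow_neg)
    moreover have "- k > 0" using 2 by simp
    ultimately have "inv x \<in> ?P" using mk(1) x by blast
    then show ?thesis by blast
  next
    case 3
    then show ?thesis using torsion_free_int_pow[OF tf x, of m] mk by auto
  qed (use mk x in blast)
next
  fix x assume "x \<in> ?P"
  then obtain m k :: int where x: "x \<in> carrier G" "m > 0" "k > 0" "x [^] m = s [^] k" by blast
  show "inv x \<notin> ?P"
  proof
    assume "inv x \<in> ?P"
    then obtain n l :: int where y: "n > 0" "l > 0" "inv x [^] n = s [^] l" by blast
    have "s [^] (k * n + l * m) = (x [^] m) [^] n \<otimes> (inv x [^] n) [^] m"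
      using s(1) x y by (simp add: int_pow_pow int_pow_mult)
    also have "\<dots> = \<one>" using x(1) by (simp add: int_pow_inv int_pow_pow mult.commute)
    finally have "k * n + l * m = 0" using torsion_free_int_pow[OF tf s(1) _ s(2)] by blast
    moreover have "k * n + l * m > 0" using x y by (simp add: add_pos_pos)
    ultimately show False by simp
  qed
next
  fix x assume "x \<in> ?P"
  then obtain m k :: int where "k > 0" "x [^] m = s [^] k" by blast
  then show "x \<notin> {\<one>}" using torsion_free_int_pow[OF tf s(1) _ s(2), of k] by auto
qed (use triv_subgroup subgroup_self in auto)

end

section \<open>Abelian and rational steps\<close>

locale abelian_step = group G for G (structure) +
  fixes K H :: "'a set"
  assumes K_sub: "subgroup K G" and H_sub: "subgroup H G" and K_le: "K \<subseteq> H"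
    and ab: "abelian_over G K H"
begin

abbreviation Q where "Q \<equiv> G\<lparr>carrier := H\<rparr> Mod K"

lemma H_carrier [simp]: "x \<in> H \<Longrightarrow> x \<in> carrier G"
  using subgroup.mem_carrier[OF H_sub] .

lemma H_closed [simp]:
  "\<one> \<in> H" "x \<in> H \<Longrightarrow> y \<in> H \<Longrightarrow> x \<otimes> y \<in> H" "x \<in> H \<Longrightarrow> inv x \<in> H"
  "x \<in> H \<Longrightarrow> x [^] (n::nat) \<in> H" "x \<in> H \<Longrightarrow> x [^] (k::int) \<in> H"
  using H_sub by (simp_all add: subgroup.one_closed subgroup.m_closed subgroup.m_inv_closed
      subgroup_nat_pow_closed subgroup_int_pow_closed)

lemma commutator_inv:
  assumes "x \<in> H" "y \<in> H" shows "x \<otimes> y \<otimes> inv x \<otimes> inv y \<in> K"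
proof -
  have "inv (inv y \<otimes> inv x) \<otimes> (inv x \<otimes> inv y) \<in> K"
    using ab assms unfolding abelian_over_def by simp
  then show ?thesis using assms by (simp add: inv_mult_group m_assoc)
qed

text \<open>Containing the commutators is enough, since x k x^-1 = (x k x^-1 k^-1) k.\<close>

lemma normal_step: "K \<lhd> G\<lparr>carrier := H\<rparr>"
proof -
  interpret GH: group "G\<lparr>carrier := H\<rparr>" using subgroup_imp_group[OF H_sub] .
  have "x \<otimes> k \<otimes> inv x \<in> K" if "x \<in> H" "k \<in> K" for x k
  proof -
    have "k \<in> H" using that K_le by blast
    then have "x \<otimes> k \<otimes> inv x \<otimes> inv k \<otimes> k \<in> K"
      using commutator_inv[of x k] that subgroup.m_closed[OF K_sub] by blast
    then show ?thesis using that \<open>k \<in> H\<close> by (simp add: m_assoc)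
  qed
  then show ?thesis
    unfolding GH.normal_inv_iff using subgroup_incl[OF K_sub H_sub K_le] H_sub by simp
qed

lemma coset_hom: "group_hom (G\<lparr>carrier := H\<rparr>) Q (\<lambda>x. K #> x)"
  using normal.r_coset_hom_Mod[OF normal_step] normal.factorgroup_is_group[OF normal_step]
    subgroup_imp_group[OF H_sub]
  by (simp add: group_hom_def group_hom_axioms_def)

lemma coset_mult: "x \<in> H \<Longrightarrow> y \<in> H \<Longrightarrow> (K #> x) \<otimes>\<^bsub>Q\<^esub> (K #> y) = K #> (x \<otimes> y)"
  using group_hom.hom_mult[OF coset_hom, of x y] by simp

lemma coset_inv: "x \<in> H \<Longrightarrow> inv\<^bsub>Q\<^esub> (K #> x) = K #> inv x"
  using group_hom.hom_inv[OF coset_hom, of x] H_sub by simp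

lemma coset_nat_pow: "x \<in> H \<Longrightarrow> (K #> x) [^]\<^bsub>Q\<^esub> (n::nat) = K #> x [^] n"
  using normal.FactGroup_pow[OF normal_step, of x n] by (simp flip: nat_pow_consistent)

lemma coset_int_pow: "x \<in> H \<Longrightarrow> (K #> x) [^]\<^bsub>Q\<^esub> (n::int) = K #> x [^] n"
  using normal.FactGroup_int_pow[OF normal_step, of x n] H_sub by (simp flip: int_pow_consistent)

lemma coset_one_iff: "x \<in> H \<Longrightarrow> K #> x = \<one>\<^bsub>Q\<^esub> \<longleftrightarrow> x \<in> K"
  using coset_join1[of K x] coset_join2[of x K] K_sub by auto

lemma carrier_Q: "carrier Q = (\<lambda>x. K #> x) ` H"
  by (simp add: carrier_FactGroup)

lemma coset_eq_iff: "x \<in> H \<Longrightarrow> y \<in> H \<Longrightarrow> K #> x = K #> y \<longleftrightarrow> x \<otimes> inv y \<in> K"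
proof -
  assume xy: "x \<in> H" "y \<in> H"
  interpret Q: group Q using normal.factorgroup_is_group[OF normal_step] .
  have c: "K #> x \<in> carrier Q" "K #> y \<in> carrier Q" using xy by (auto simp: carrier_Q)
  have "K #> x = K #> y \<longleftrightarrow> (K #> x) \<otimes>\<^bsub>Q\<^esub> inv\<^bsub>Q\<^esub> (K #> y) = \<one>\<^bsub>Q\<^esub>"
    using Q.inv_solve_right'[OF Q.one_closed c] Q.l_one[OF c(2)] by (metis (no_types))
  also have "\<dots> \<longleftrightarrow> x \<otimes> inv y \<in> K"
    using xy coset_one_iff[of "x \<otimes> inv y"] by (simp add: coset_inv coset_mult del: one_FactGroup mult_FactGroup)
  finally show ?thesis .
qed

lemma comm_group_Q: "comm_group Q"
proof (rule group.group_comm_groupI)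
  show "group Q" using normal.factorgroup_is_group[OF normal_step] .
next
  fix U V assume "U \<in> carrier Q" "V \<in> carrier Q"
  then obtain x y where xy: "x \<in> H" "y \<in> H" "U = K #> x" "V = K #> y" by (auto simp: carrier_Q)
  have "x \<otimes> y \<otimes> inv (y \<otimes> x) \<in> K"
    using commutator_inv[of x y] xy by (simp add: inv_mult_group m_assoc)
  then have "K #> (x \<otimes> y) = K #> (y \<otimes> x)" using coset_eq_iff xy by simp
  then show "U \<otimes>\<^bsub>Q\<^esub> V = V \<otimes>\<^bsub>Q\<^esub> U" using xy by (simp add: coset_mult del: mult_FactGroup)
qed

lemma torsion_free_Q_iff:
  "torsion_free Q \<longleftrightarrow> (\<forall>x\<in>H. \<forall>n::nat. n > 0 \<and> x [^] n \<in> K \<longrightarrow> x \<in> K)"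
  unfolding torsion_free_def carrier_Q
  by (simp add: coset_nat_pow coset_one_iff del: one_FactGroup)

lemma commensurable_Q_iff:
  assumes "s \<in> H" "x \<in> H"
  shows "commensurable Q {\<one>\<^bsub>Q\<^esub>} (K #> s) (K #> x) \<longleftrightarrow> commensurable G K s x"
  unfolding commensurable_def using assms
  by (simp add: coset_nat_pow coset_int_pow coset_mult coset_one_iff del: one_FactGroup mult_FactGroup)

lemma cone_image:
  assumes "cone G K H P" shows "cone Q {\<one>\<^bsub>Q\<^esub>} (carrier Q) ((\<lambda>x. K #> x) ` P)"
proof -
  interpret cone G K H P by fact
  interpret Q: comm_group Q by (rule comm_group_Q)
  \<comment> \<open>\<open>P\<close> is a union of cosets of \<open>K\<close>, so the sign of a
    coset can be read off any representative.\<close>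
  have mem: "K #> x \<in> (\<lambda>x. K #> x) ` P \<longleftrightarrow> x \<in> P" if x: "x \<in> H" for x
  proof
    assume "K #> x \<in> (\<lambda>x. K #> x) ` P"
    then obtain p where p: "p \<in> P" "K #> x = K #> p" by blast
    then have "x \<otimes> inv p \<in> K" using coset_eq_iff x mem_H by simp
    then have "x \<otimes> inv p \<otimes> p \<in> P" using K_mult_P p by blast
    then show "x \<in> P" using x p by (simp add: m_assoc)
  qed simp
  show ?thesis
  proof (rule Q.coneI)
    show "(\<lambda>x. K #> x) ` P \<subseteq> carrier Q" using mem_H by (auto simp: carrier_Q)
  next
    fix U V assume "U \<in> (\<lambda>x. K #> x) ` P" "V \<in> (\<lambda>x. K #> x) ` P"
    then show "U \<otimes>\<^bsub>Q\<^esub> V \<in> (\<lambda>x. K #> x) ` P"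
      using mem_H P_mult by (auto simp: coset_mult simp del: mult_FactGroup)
  next
    fix U assume "U \<in> carrier Q"
    then obtain x where x: "x \<in> H" "U = K #> x" by (auto simp: carrier_Q)
    then show "U \<in> (\<lambda>x. K #> x) ` P \<or> inv\<^bsub>Q\<^esub> U \<in> (\<lambda>x. K #> x) ` P \<or> U \<in> {\<one>\<^bsub>Q\<^esub>}"
      using P_cases[OF x(1)] by (auto simp: coset_inv coset_one_iff simp del: one_FactGroup)
  next
    fix U assume "U \<in> (\<lambda>x. K #> x) ` P"
    then obtain x where x: "x \<in> P" "U = K #> x" by blast
    then show "inv\<^bsub>Q\<^esub> U \<notin> (\<lambda>x. K #> x) ` P" "U \<notin> {\<one>\<^bsub>Q\<^esub>}"
      using P_inv P_K mem_H mem by (simp_all add: coset_inv coset_one_iff del: one_FactGroup)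
  qed (use Q.triv_subgroup Q.subgroup_self Q.one_closed in auto)
qed

lemma cone_preimage:
  assumes "cone Q {\<one>\<^bsub>Q\<^esub>} (carrier Q) R" shows "cone G K H {x \<in> H. K #> x \<in> R}"
proof -
  interpret R: cone Q "{\<one>\<^bsub>Q\<^esub>}" "carrier Q" R by fact
  show ?thesis
  proof (rule coneI)
    fix x y assume "x \<in> {x \<in> H. K #> x \<in> R}" "y \<in> {x \<in> H. K #> x \<in> R}"
    then show "x \<otimes> y \<in> {x \<in> H. K #> x \<in> R}"
      using R.P_mult[of "K #> x" "K #> y"] by (simp add: coset_mult del: mult_FactGroup)
  next
    fix x assume x: "x \<in> H"
    then have "K #> x \<in> carrier Q" by (simp add: carrier_Q)
    then show "x \<in> {x \<in> H. K #> x \<in> R} \<or> inv x \<in> {x \<in> H. K #> x \<in> R} \<or> x \<in> K"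
      using R.P_cases[of "K #> x"] x coset_one_iff[OF x] by (auto simp: coset_inv simp del: one_FactGroup)
  next
    fix x assume "x \<in> {x \<in> H. K #> x \<in> R}"
    then show "inv x \<notin> {x \<in> H. K #> x \<in> R}" "x \<notin> K"
      using R.P_inv[of "K #> x"] R.P_K[of "K #> x"] coset_one_iff[of x]
      by (auto simp: coset_inv simp del: one_FactGroup)
  qed (use K_sub H_sub K_le in auto)
qed

text \<open>Images and preimages under the coset map turn uniqueness of the cone of \<open>H\<close>
  relative to \<open>K\<close> into uniqueness in the abelian quotient, where the spanning argument
  applies. The witness being in \<open>F\<close> is what later bounds the number of jumps.\<close>

lemma unique_cone_commensurable:
  assumes "cone G K H P" "H \<noteq> K" and F: "finite F" "F \<subseteq> P"
    and unique: "\<And>S. cone G K H S \<Longrightarrow> F \<subseteq> S \<Longrightarrow> S = P"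
  obtains s where "s \<in> F" "\<And>x. x \<in> H \<Longrightarrow> commensurable G K s x"
proof -
  interpret cone G K H P by fact
  interpret Q: comm_group Q by (rule comm_group_Q)
  obtain x where x: "x \<in> H" "x \<notin> K" using assms(2) K_le by blast
  then have "P \<noteq> {}" using P_cases by blast
  have "R = (\<lambda>x. K #> x) ` P"
    if R: "cone Q {\<one>\<^bsub>Q\<^esub>} (carrier Q) R" "(\<lambda>x. K #> x) ` F \<subseteq> R" for R
  proof -
    have "{x \<in> H. K #> x \<in> R} = P"
      using unique[OF cone_preimage[OF R(1)]] R(2) F(2) mem_H by blast
    moreover have "R \<subseteq> carrier Q" using cone.P_le_H[OF R(1)] .
    ultimately show ?thesis unfolding carrier_Q by blast
  qed
  then obtain U where U: "U \<in> (\<lambda>x. K #> x) ` F" "\<forall>V\<in>carrier Q. commensurable Q {\<one>\<^bsub>Q\<^esub>} U V"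
    using Q.unique_cone_rank_one[OF cone_image[OF assms(1)], of "(\<lambda>x. K #> x) ` F"] \<open>P \<noteq> {}\<close> F by blast
  then obtain s where s: "s \<in> F" "U = K #> s" by blast
  then have "s \<in> H" using F mem_H by blast
  then have "commensurable G K s x" if "x \<in> H" for x
    using U(2) s that commensurable_Q_iff by (simp add: carrier_Q del: one_FactGroup)
  then show ?thesis using that s(1) by blast
qed

end

text \<open>The quotient-free form of a torsion-free abelian factor of rank one, as
  \<open>rational_step_iff\<close> shows. It can be combined directly with cones and convex
  subgroups, which are subsets of \<open>G\<close>.\<close>

definition rational_step :: "('a, 'm) monoid_scheme \<Rightarrow> 'a set \<Rightarrow> 'a set \<Rightarrow> bool" where
  "rational_step G K H \<longleftrightarrow> abelian_step G K H \<and>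
     (\<forall>x\<in>H. \<forall>n::nat. n > 0 \<and> x [^]\<^bsub>G\<^esub> n \<in> K \<longrightarrow> x \<in> K) \<and>
     (\<exists>s\<in>H - K. \<forall>x\<in>H. commensurable G K s x)"

lemma (in group) abelian_step_iff:
  assumes "subgroup K G" "subgroup H G"
  shows "K \<lhd> G\<lparr>carrier := H\<rparr> \<and> comm_group (G\<lparr>carrier := H\<rparr> Mod K) \<longleftrightarrow> abelian_step G K H"
proof
  assume "abelian_step G K H"
  then show "K \<lhd> G\<lparr>carrier := H\<rparr> \<and> comm_group (G\<lparr>carrier := H\<rparr> Mod K)"
    using abelian_step.normal_step abelian_step.comm_group_Q by blast
next
  assume n: "K \<lhd> G\<lparr>carrier := H\<rparr> \<and> comm_group (G\<lparr>carrier := H\<rparr> Mod K)"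
  then interpret N: normal K "G\<lparr>carrier := H\<rparr>" by simp
  interpret Q: comm_group "G\<lparr>carrier := H\<rparr> Mod K" using n by simp
  have KH: "K \<subseteq> H" using N.subset by simp
  have Hc: "x \<in> carrier G" if "x \<in> H" for x using subgroup.mem_carrier[OF assms(2) that] .
  show "abelian_step G K H"
  proof (intro abelian_step.intro abelian_step_axioms.intro is_group assms KH)
    show "abelian_over G K H"
      unfolding abelian_over_def
    proof (intro ballI)
      fix x y assume xy: "x \<in> H" "y \<in> H"
      have inv: "inv x \<in> H" "inv y \<in> H" using xy assms(2) by (simp_all add: subgroup.m_inv_closed)
      \<comment> \<open>Inverse cosets are commuted because the equation x^-1 y^-1 = k y^-1 x^-1
        then identifies \<open>k\<close> with the commutator in the form used by
        \<open>abelian_over\<close>.\<close>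
      have "(K #> inv y) <#> (K #> inv x) = (K #> inv x) <#> (K #> inv y)"
        using Q.m_comm[of "K #> inv y" "K #> inv x"] inv by (simp add: carrier_FactGroup)
      then have "K #> (inv y \<otimes> inv x) = K #> (inv x \<otimes> inv y)"
        using N.rcos_sum[of "inv x" "inv y"] N.rcos_sum[of "inv y" "inv x"] inv by simp
      moreover have "inv x \<otimes> inv y \<in> K #> (inv x \<otimes> inv y)"
        using rcos_self[OF _ assms(1)] xy Hc by simp
      ultimately obtain k where k: "k \<in> K" "inv x \<otimes> inv y = k \<otimes> (inv y \<otimes> inv x)"
        by (auto simp: r_coset_def)
      have kc: "k \<in> carrier G" using k KH Hc by blast
      have "inv (y \<otimes> x) \<otimes> (x \<otimes> y) = k \<otimes> (inv y \<otimes> inv x) \<otimes> (x \<otimes> y)"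
        using k(2) xy Hc by (simp add: inv_mult_group)
      also have "\<dots> = k" using kc xy Hc by (simp add: m_assoc)
      finally show "inv (y \<otimes> x) \<otimes> (x \<otimes> y) \<in> K" using k(1) by simp
    qed
  qed
qed

lemma (in group) rational_step_iff:
  assumes "subgroup K G" "subgroup H G"
  shows "K \<lhd> G\<lparr>carrier := H\<rparr> \<and> comm_group (G\<lparr>carrier := H\<rparr> Mod K) \<and>
      torsion_free (G\<lparr>carrier := H\<rparr> Mod K) \<and> has_rank (G\<lparr>carrier := H\<rparr> Mod K) 1
    \<longleftrightarrow> rational_step G K H"
proof (cases "abelian_step G K H")
  case True
  then interpret abelian_step G K H .
  interpret Q: comm_group Q by (rule comm_group_Q)
  have "(\<exists>S\<in>carrier Q - {\<one>\<^bsub>Q\<^esub>}. \<forall>U\<in>carrier Q. commensurable Q {\<one>\<^bsub>Q\<^esub>} S U)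
    \<longleftrightarrow> (\<exists>s\<in>H - K. \<forall>x\<in>H. commensurable G K s x)" (is "?l \<longleftrightarrow> ?r")
  proof
    assume ?l
    then obtain S where S: "S \<in> carrier Q" "S \<noteq> \<one>\<^bsub>Q\<^esub>" "\<forall>U\<in>carrier Q. commensurable Q {\<one>\<^bsub>Q\<^esub>} S U" by blast
    then obtain s where s: "s \<in> H" "S = K #> s" by (auto simp: carrier_Q)
    then have "s \<notin> K" using S(2) coset_one_iff by blast
    moreover have "commensurable G K s x" if "x \<in> H" for x
      using S(3) s that commensurable_Q_iff by (simp add: carrier_Q del: one_FactGroup)
    ultimately show ?r using s by blast
  next
    assume ?r
    then obtain s where s: "s \<in> H" "s \<notin> K" "\<And>x. x \<in> H \<Longrightarrow> commensurable G K s x" by blast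
    then have "K #> s \<in> carrier Q - {\<one>\<^bsub>Q\<^esub>}" using coset_one_iff[of s] by (auto simp: carrier_Q)
    moreover have "commensurable Q {\<one>\<^bsub>Q\<^esub>} (K #> s) U" if "U \<in> carrier Q" for U
      using that s commensurable_Q_iff by (auto simp: carrier_Q simp del: one_FactGroup)
    ultimately show ?l by blast
  qed
  then have "torsion_free Q \<and> has_rank Q 1 \<longleftrightarrow>
      torsion_free Q \<and> (\<exists>s\<in>H - K. \<forall>x\<in>H. commensurable G K s x)"
    using Q.has_rank_one_iff by metis
  then show ?thesis
    unfolding rational_step_def torsion_free_Q_iff[symmetric]
    by (simp only: True normal_step comm_group_Q simp_thms)
next
  case False
  then show ?thesis using abelian_step_iff[OF assms] unfolding rational_step_def by blast
qed

lemma (in group) rational_step_commensurable: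
  assumes "rational_step G K H" "g \<in> H" "g \<notin> K" "x \<in> H"
  shows "commensurable G K g x"
proof -
  interpret abelian_step G K H using assms(1) by (simp add: rational_step_def)
  interpret Q: comm_group Q by (rule comm_group_Q)
  obtain s where s: "s \<in> H" "\<And>x. x \<in> H \<Longrightarrow> commensurable G K s x"
    using assms(1) by (auto simp: rational_step_def)
  have "commensurable Q {\<one>\<^bsub>Q\<^esub>} (K #> g) (K #> x)"
  proof (rule Q.commensurable_trans[of "K #> s"])
    show "torsion_free Q" using assms(1) by (simp add: torsion_free_Q_iff rational_step_def)
    show "K #> g \<noteq> \<one>\<^bsub>Q\<^esub>" using coset_one_iff assms by blast
    show "commensurable Q {\<one>\<^bsub>Q\<^esub>} (K #> s) (K #> g)" "commensurable Q {\<one>\<^bsub>Q\<^esub>} (K #> s) (K #> x)"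
      using commensurable_Q_iff s assms by blast+
  qed (use s(1) assms in \<open>simp_all add: carrier_Q\<close>)
  then show ?thesis using commensurable_Q_iff assms by blast
qed

lemma (in group) card_rational_step_cones:
  assumes "rational_step G K H" shows "card {P. cone G K H P} = 2"
proof -
  interpret abelian_step G K H using assms(1) by (simp add: rational_step_def)
  interpret Q: comm_group Q by (rule comm_group_Q)
  obtain s where s: "s \<in> H" "s \<notin> K" "\<And>x. x \<in> H \<Longrightarrow> commensurable G K s x"
    using assms(1) by (auto simp: rational_step_def)
  define R where "R = {x \<in> carrier Q. \<exists>m>0. \<exists>k>0. x [^]\<^bsub>Q\<^esub> (m::int) = (K #> s) [^]\<^bsub>Q\<^esub> (k::int)}"
  have R: "cone Q {\<one>\<^bsub>Q\<^esub>} (carrier Q) R"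
    unfolding R_def
  proof (rule Q.rank_one_cone)
    show "torsion_free Q" using assms(1) by (simp add: torsion_free_Q_iff rational_step_def)
    show "K #> s \<noteq> \<one>\<^bsub>Q\<^esub>" using coset_one_iff s by blast
    fix U assume "U \<in> carrier Q"
    then show "commensurable Q {\<one>\<^bsub>Q\<^esub>} (K #> s) U"
      using commensurable_Q_iff s by (auto simp: carrier_Q simp del: one_FactGroup)
  qed (use s in \<open>simp add: carrier_Q\<close>)
  define T where "T = {x \<in> H. K #> x \<in> R}"
  interpret T: cone G K H T unfolding T_def using cone_preimage[OF R] .
  have "K #> s \<in> R" unfolding R_def using s by (auto simp: carrier_Q intro!: exI[of _ 1])
  then have sT: "s \<in> T" using s by (simp add: T_def)
  have eq: "P = T" if P: "cone G K H P" "s \<in> P" for P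
  proof -
    interpret P: cone G K H P by fact
    have "T \<subseteq> P"
    proof
      fix x assume "x \<in> T"
      then obtain m k :: int where x: "x \<in> H" "m > 0" "k > 0" "(K #> x) [^]\<^bsub>Q\<^esub> m = (K #> s) [^]\<^bsub>Q\<^esub> k"
        by (auto simp: T_def R_def)
      have "K #> x [^] nat m = K #> s [^] nat k"
        using x s by (simp add: coset_int_pow pow_nat)
      then have "x [^] nat m \<otimes> inv (s [^] nat k) \<in> K" using coset_eq_iff x s by simp
      moreover have "s [^] nat k \<in> P" using P.P_pow[OF P(2)] x(3) by (metis zero_less_nat_eq)
      ultimately have "x [^] nat m \<otimes> inv (s [^] nat k) \<otimes> s [^] nat k \<in> P" using P.K_mult_P by blast
      then have "x [^] nat m \<in> P" using x s by (simp add: m_assoc)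
      then show "x \<in> P" using P.pow_in_P[OF x(1)] x(2) by (metis zero_less_nat_eq)
    qed
    then show ?thesis using P.sub_cone_eq[OF T.cone_axioms] by simp
  qed
  define T' where "T' = {x \<in> H. inv x \<in> T}"
  have "P = T \<or> P = T'" if P: "cone G K H P" for P
  proof -
    interpret P: cone G K H P by fact
    consider "s \<in> P" | "inv s \<in> P" using P.P_cases s by blast
    then show ?thesis
    proof cases
      case 2
      then have "{x \<in> H. inv x \<in> P} = T" using eq[OF P.cone_inverse] s by simp
      then have "T' = P" using P.mem_H by (auto simp: T'_def)
      then show ?thesis by simp
    qed (use eq P in blast)
  qed
  moreover have "cone G K H T'" unfolding T'_def by (rule T.cone_inverse)
  ultimately have "{P. cone G K H P} = {T, T'}" using T.cone_axioms by blast
  moreover have "T \<noteq> T'" using sT T.P_inv by (auto simp: T'_def)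
  ultimately show ?thesis by simp
qed

section \<open>Chains of rational steps\<close>

lemma conrad_cone_iff: "conrad_cone G K H P \<longleftrightarrow> cone G K H P \<and> conrad G P"
  by (simp add: conrad_cone_def conrad_cone_axioms_def)

lemma rational_stepD:
  assumes "rational_step G K H"
  shows "subgroup K G" "subgroup H G" "K \<subset> H" "abelian_step G K H" "abelian_over G K H"
  using assms by (auto simp: rational_step_def abelian_step_def abelian_step_axioms_def)

context cone
begin

text \<open>Convex subgroups are closed under roots. Consequently no convex subgroup lies strictly
  between the two terms of a rational step.\<close>

lemma convex_commensurable:
  assumes M: "convex M" and "K' \<subseteq> M" "s \<in> M" "x \<in> H" "commensurable G K' s x"
  shows "x \<in> M"
proof -
  obtain m :: nat and k :: int where mk: "m > 0" "x [^] m \<otimes> s [^] k \<in> M"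
    using assms(2,5) by (auto simp: commensurable_def)
  have "s [^] k \<in> M" using convexD(1)[OF M] assms(3) by (rule subgroup_int_pow_closed)
  then have "x [^] m \<in> M"
    using subgroup_mult_right_iff[OF convexD(1)[OF M], of "s [^] k" "x [^] m"] mk assms(4) by simp
  then show ?thesis using convex_pow[OF M assms(4) mk(1)] by blast
qed

end

context conrad_cone
begin

lemma rational_step_convex:
  assumes N: "rational_step G N H" and N': "K \<subseteq> N'" "rational_step G N' N"
    and conv: "cone.convex G K N (P \<inter> N) N'" and nonab: "\<not> abelian_step G N' H"
  shows "convex N"
proof -
  have KN: "subgroup N G" "K \<subseteq> N" "N \<subseteq> H" using rational_stepD(1,3)[OF N] rational_stepD(3)[OF N'(2)] N'(1) by auto
  interpret R: cone G K N "P \<inter> N" using cone_restrict[OF KN] .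
  obtain s where s: "s \<in> N" "s \<notin> N'" using rational_stepD(3)[OF N'(2)] by blast
  then have "s \<in> P \<or> inv s \<in> P" using P_cases KN N'(1) by blast
  moreover have "inv s \<in> N" "inv s \<notin> N'"
    using s rational_stepD(1,2)[OF N'(2)] KN by (auto simp: subgroup_inv_iff)
  ultimately obtain h where h: "h \<in> N" "h \<notin> N'" "h \<in> P" using s by blast
  have comm: "commensurable G N' x y" if "x \<in> N" "x \<notin> N'" "y \<in> N" for x y
    using rational_step_commensurable[OF N'(2)] that by blast
  have hull: "convex (hull_of h)" "h \<in> hull_of h" using convex_hull mem_hull h by auto
  \<comment> \<open>Both \<open>N'\<close> and the trace of the hull on \<open>N\<close> are convex
    in \<open>N\<close>, hence comparable, and \<open>h\<close> lies only in the latter.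
    Commensurability then carries all of \<open>N\<close> into the hull.\<close>
  have "N' \<subseteq> hull_of h"
    using R.convex_chain[OF conv convex_restrict[OF hull(1) KN]] hull(2) h by blast
  then have "N \<subseteq> hull_of h"
    using convex_commensurable[OF hull(1) _ hull(2)] comm[OF h(1,2)] KN by blast
  show ?thesis
  proof (cases "hull_of h = N")
    case False
    then obtain g where g: "g \<in> hull_of h" "g \<notin> N" using \<open>N \<subseteq> hull_of h\<close> by blast
    have "x \<in> hull_of h" if "x \<in> H" for x
      using convex_commensurable[OF hull(1) \<open>N \<subseteq> hull_of h\<close> g(1) that]
        rational_step_commensurable[OF N _ g(2) that] g(1) convexD(3)[OF hull(1)] by blast
    then have "hull_of h = H" using convexD(3)[OF hull(1)] by blast
    then have ab: "abelian_over G (under h) H" using jump_abelian[OF h(3)] by simp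
    have conv_under: "convex (under h)" using convex_under h by blast
    \<comment> \<open>Otherwise \<open>under h\<close> contains \<open>N'\<close> and an element of
      \<open>N\<close> outside it. Every element of \<open>N\<close>, in particular
      \<open>h\<close>, is commensurable with that element and would lie in
      \<open>under h\<close>.\<close>
    have "under h \<inter> N \<subseteq> N'"
    proof (rule ccontr)
      assume neg: "\<not> ?thesis"
      then have "N' \<subseteq> under h"
        using R.convex_chain[OF conv convex_restrict[OF conv_under KN]] by blast
      moreover obtain x where "x \<in> under h" "x \<in> N" "x \<notin> N'" using neg by blast
      ultimately have "h \<in> under h"
        using convex_commensurable[OF conv_under _ _ mem_H(1)[OF h(3)]] comm h(1) by blast
      then show False using not_mem_under by blast
    qed
    then have "abelian_over G N' H"
      using ab rational_stepD(5)[OF N] unfolding abelian_over_def by blast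
    then have "abelian_step G N' H"
      using rational_stepD[OF N] rational_stepD[OF N'(2)]
      by (intro abelian_step.intro abelian_step_axioms.intro) (auto intro: is_group)
    then show ?thesis using nonab by blast
  qed (use hull in simp)
qed

end

definition rational_chain :: "('a, 'm) monoid_scheme \<Rightarrow> 'a set list \<Rightarrow> bool" where
  "rational_chain G Gs \<longleftrightarrow> Gs \<noteq> [] \<and> (\<forall>H\<in>set Gs. subgroup H G) \<and>
     (\<forall>i. Suc i < length Gs \<longrightarrow> rational_step G (Gs ! i) (Gs ! Suc i))"

definition jump_free :: "('a, 'm) monoid_scheme \<Rightarrow> 'a set list \<Rightarrow> bool" where
  "jump_free G Gs \<longleftrightarrow> (\<forall>i. i + 2 < length Gs \<longrightarrow> \<not> abelian_step G (Gs ! i) (Gs ! (i + 2)))"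

context group
begin

lemma rational_series_iff_chain: "rational_series G Gs \<longleftrightarrow> rational_chain G Gs"
proof (cases "\<forall>H\<in>set Gs. subgroup H G")
  case True
  then have "subgroup (Gs ! i) G" if "i < length Gs" for i using that by simp
  then show ?thesis
    unfolding rational_series_def rational_chain_def
    using rational_step_iff by (metis Suc_lessD)
qed (auto simp: rational_series_def rational_chain_def)

lemma has_abelian_jump_iff:
  assumes "\<forall>H\<in>set Gs. subgroup H G" shows "has_abelian_jump G Gs \<longleftrightarrow> \<not> jump_free G Gs"
proof -
  have "subgroup (Gs ! i) G" if "i < length Gs" for i using that assms by simp
  then have "Gs ! i \<lhd> G\<lparr>carrier := Gs ! (i + 2)\<rparr> \<and> comm_group (G\<lparr>carrier := Gs ! (i + 2)\<rparr> Mod Gs ! i)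
      \<longleftrightarrow> abelian_step G (Gs ! i) (Gs ! (i + 2))" if "i + 2 < length Gs" for i
    using that by (intro abelian_step_iff) auto
  then show ?thesis unfolding has_abelian_jump_def jump_free_def by blast
qed

lemma rational_chain_strict_mono:
  assumes "rational_chain G Gs" shows "i < j \<Longrightarrow> j < length Gs \<Longrightarrow> Gs ! i \<subset> Gs ! j"
proof (induction j)
  case (Suc j)
  have "Gs ! j \<subset> Gs ! Suc j"
    using assms Suc(3) rational_stepD(3) unfolding rational_chain_def by blast
  moreover have "Gs ! i \<subseteq> Gs ! j" using Suc by (cases "i = j") auto
  ultimately show ?case by blast
qed simp

lemma rational_chain_mono:
  "rational_chain G Gs \<Longrightarrow> i \<le> j \<Longrightarrow> j < length Gs \<Longrightarrow> Gs ! i \<subseteq> Gs ! j"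
  using rational_chain_strict_mono[of Gs i j] by (cases "i = j") auto

text \<open>The cone is generalized in the induction because the hypothesis is applied to its
  restriction to the previous term. That term is then convex by \<open>rational_step_convex\<close>,
  and earlier terms follow by transitivity of convexity.\<close>

lemma jump_free_convex:
  assumes chain: "rational_chain G Gs" and jf: "jump_free G Gs"
  shows "\<lbrakk>i < length Gs; conrad_cone G (Gs ! 0) (Gs ! i) P; j \<le> i\<rbrakk>
    \<Longrightarrow> cone.convex G (Gs ! 0) (Gs ! i) P (Gs ! j)"
proof (induction i arbitrary: P j)
  case 0
  then show ?case using cone.convex_K conrad_cone_iff by (metis le_zero_eq)
next
  case (Suc i)
  interpret P: conrad_cone G "Gs ! 0" "Gs ! Suc i" P by fact
  show ?case
  proof (cases "j = Suc i")
    case True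
    then show ?thesis using P.convex_H by simp
  next
    case False
    have step: "rational_step G (Gs ! i) (Gs ! Suc i)" using chain Suc(2) by (simp add: rational_chain_def)
    have sub: "subgroup (Gs ! i) G" "Gs ! 0 \<subseteq> Gs ! i" "Gs ! i \<subseteq> Gs ! Suc i"
      using rational_stepD[OF step] rational_chain_mono[OF chain, of 0 i] Suc(2) by auto
    have R: "conrad_cone G (Gs ! 0) (Gs ! i) (P \<inter> Gs ! i)"
      unfolding conrad_cone_iff using P.cone_restrict[OF sub] P.conrad_restrict[OF P.conrad_P sub(1)] by blast
    have conv: "cone.convex G (Gs ! 0) (Gs ! i) (P \<inter> Gs ! i) (Gs ! j)" if "j \<le> i" for j
      using Suc(1)[OF _ R that] Suc(2) by simp
    have "P.convex (Gs ! i)"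
    proof (cases i)
      case 0
      then show ?thesis using P.convex_K by simp
    next
      case (Suc k)
      have "rational_step G (Gs ! k) (Gs ! i)" "\<not> abelian_step G (Gs ! k) (Gs ! Suc i)"
        using chain jf \<open>Suc i < length Gs\<close> Suc unfolding rational_chain_def jump_free_def
        by (auto simp: numeral_2_eq_2)
      then show ?thesis
        using P.rational_step_convex[OF step, of "Gs ! k"] conv[of k]
          rational_chain_mono[OF chain, of 0 k] Suc \<open>Suc i < length Gs\<close> by simp
    qed
    then show ?thesis using P.convex_trans conv[of j] False Suc(4) by simp
  qed
qed

text \<open>Convexity of the previous term makes cutting a cone into its parts inside and outside
  that term inverse to lexicographic composition. On the last factor every cone is Conradian, being
  a cone on an abelian step, so each step doubles the count.\<close>

lemma card_conrad_cones:
  assumes chain: "rational_chain G Gs" and jf: "jump_free G Gs"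
  shows "i < length Gs \<Longrightarrow> card {P. conrad_cone G (Gs ! 0) (Gs ! i) P} = 2 ^ i"
proof (induction i)
  case 0
  have sub: "subgroup (Gs ! 0) G" using chain 0 by (simp add: rational_chain_def)
  have "conrad_cone G (Gs ! 0) (Gs ! 0) P \<longleftrightarrow> P = {}" for P
  proof
    assume "conrad_cone G (Gs ! 0) (Gs ! 0) P"
    then interpret conrad_cone G "Gs ! 0" "Gs ! 0" P .
    show "P = {}" using P_le_H P_K by blast
  next
    assume "P = {}"
    then show "conrad_cone G (Gs ! 0) (Gs ! 0) P"
      unfolding conrad_cone_iff conrad_def using sub by (auto intro!: coneI)
  qed
  then show ?case by simp
next
  case (Suc i)
  define A where "A = {P. conrad_cone G (Gs ! 0) (Gs ! i) P}"
  define B where "B = {S. cone G (Gs ! i) (Gs ! Suc i) S}"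
  have step: "rational_step G (Gs ! i) (Gs ! Suc i)" using chain Suc(2) by (simp add: rational_chain_def)
  have "{P. conrad_cone G (Gs ! 0) (Gs ! Suc i) P} = (\<lambda>(Q, S). Q \<union> S) ` (A \<times> B)"
  proof (intro equalityI subsetI)
    fix P assume "P \<in> {P. conrad_cone G (Gs ! 0) (Gs ! Suc i) P}"
    then have P: "conrad_cone G (Gs ! 0) (Gs ! Suc i) P" by simp
    then interpret P: conrad_cone G "Gs ! 0" "Gs ! Suc i" P .
    have conv: "P.convex (Gs ! i)" using jump_free_convex[OF chain jf Suc(2) P, of i] by simp
    have "P \<inter> Gs ! i \<in> A"
      using P.cone_restrict[OF P.convexD(1-3)[OF conv]] P.conrad_restrict[OF P.conrad_P P.convexD(1)[OF conv]]
      by (simp add: A_def conrad_cone_iff)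
    moreover have "P - Gs ! i \<in> B" using P.cone_convex_quotient[OF conv] by (simp add: B_def)
    ultimately show "P \<in> (\<lambda>(Q, S). Q \<union> S) ` (A \<times> B)"
      by (auto intro!: image_eqI[of _ _ "(P \<inter> Gs ! i, P - Gs ! i)"])
  next
    fix P assume "P \<in> (\<lambda>(Q, S). Q \<union> S) ` (A \<times> B)"
    then obtain Q S where QS: "Q \<in> A" "S \<in> B" "P = Q \<union> S" by auto
    then interpret Q: conrad_cone G "Gs ! 0" "Gs ! i" Q by (simp add: A_def)
    interpret S: cone G "Gs ! i" "Gs ! Suc i" S using QS by (simp add: B_def)
    show "P \<in> {P. conrad_cone G (Gs ! 0) (Gs ! Suc i) P}"
      using Q.cone_compose[OF S.cone_axioms] Q.conrad_compose[OF S.cone_axioms Q.conrad_P]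
        S.abelian_conrad rational_stepD(5)[OF step] QS(3) by (simp add: conrad_cone_iff)
  qed
  moreover have "inj_on (\<lambda>(Q, S). Q \<union> S) (A \<times> B)"
  proof (rule inj_onI, clarify)
    fix Q S Q' S' assume QS: "Q \<in> A" "S \<in> B" "Q' \<in> A" "S' \<in> B" "Q \<union> S = Q' \<union> S'"
    have 1: "Q \<subseteq> Gs ! i" if "Q \<in> A" for Q using that cone.P_le_H conrad_cone_iff unfolding A_def by blast
    have 2: "S \<inter> Gs ! i = {}" if "S \<in> B" for S using that unfolding B_def by (auto dest: cone.P_K)
    show "Q = Q' \<and> S = S'" using 1[OF QS(1)] 1[OF QS(3)] 2[OF QS(2)] 2[OF QS(4)] QS(5) by blast
  qed
  ultimately have "card {P. conrad_cone G (Gs ! 0) (Gs ! Suc i) P} = card A * card B"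
    by (simp add: card_image card_cartesian_product)
  then show ?case
    using Suc card_rational_step_cones[OF step] by (simp add: A_def B_def)
qed

text \<open>Lexicographic composition along an arbitrary chain, with abelian jumps allowed. This
  generality lets the uniqueness proof start from the competing series.\<close>

lemma rational_chain_cone_exists:
  assumes chain: "rational_chain G Gs"
  shows "i < length Gs \<Longrightarrow> \<exists>P. conrad_cone G (Gs ! 0) (Gs ! i) P \<and>
    (\<forall>j\<le>i. cone.convex G (Gs ! 0) (Gs ! i) P (Gs ! j))"
proof (induction i)
  case 0
  have "subgroup (Gs ! 0) G" using chain 0 by (simp add: rational_chain_def)
  then have c: "conrad_cone G (Gs ! 0) (Gs ! 0) {}"
    unfolding conrad_cone_iff conrad_def by (auto intro!: coneI)
  then show ?case using cone.convex_K conrad_cone_iff by (metis le_zero_eq)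
next
  case (Suc i)
  then obtain P where P: "conrad_cone G (Gs ! 0) (Gs ! i) P"
    and conv: "\<And>j. j \<le> i \<Longrightarrow> cone.convex G (Gs ! 0) (Gs ! i) P (Gs ! j)" by auto
  interpret P: conrad_cone G "Gs ! 0" "Gs ! i" P by fact
  have step: "rational_step G (Gs ! i) (Gs ! Suc i)" using chain Suc(2) by (simp add: rational_chain_def)
  have "{S. cone G (Gs ! i) (Gs ! Suc i) S} \<noteq> {}"
    using card_rational_step_cones[OF step] by (metis card.empty zero_neq_numeral)
  then obtain S where S: "cone G (Gs ! i) (Gs ! Suc i) S" by blast
  interpret S: cone G "Gs ! i" "Gs ! Suc i" S by fact
  interpret PS: conrad_cone G "Gs ! 0" "Gs ! Suc i" "P \<union> S"
    using P.cone_compose[OF S] P.conrad_compose[OF S P.conrad_P]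
      S.abelian_conrad rational_stepD(5)[OF step] by (simp add: conrad_cone_iff)
  have "(P \<union> S) - Gs ! i = S" "(P \<union> S) \<inter> Gs ! i = P"
    using P.P_le_H S.P_K by blast+
  then have "PS.convex (Gs ! i)"
    using S P.K_le_H by (simp add: PS.convex_iff_cone)
  then have "PS.convex (Gs ! j)" if "j \<le> Suc i" for j
    using PS.convex_trans[of "Gs ! i" "Gs ! j"] conv[of j] \<open>(P \<union> S) \<inter> Gs ! i = P\<close> PS.convex_H that
    by (cases "j = Suc i") auto
  then show ?case using PS.conrad_cone_axioms by blast
qed

text \<open>Let \<open>Gs ! i\<close> be the largest term inside the convex subgroup
  \<open>M\<close>. The next term is not inside \<open>M\<close>, so it contains \<open>M\<close>,
  and a rational step has no convex subgroup strictly between its terms.\<close>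

lemma set_rational_chain:
  assumes chain: "rational_chain G Gs" "hd Gs = C" "last Gs = H" and P: "cone G C H P"
    and conv: "\<And>M. M \<in> set Gs \<Longrightarrow> cone.convex G C H P M"
  shows "set Gs = {M. cone.convex G C H P M}"
proof (intro equalityI subsetI)
  interpret P: cone G C H P by fact
  fix M assume "M \<in> {M. P.convex M}"
  then have M: "P.convex M" by simp
  have ne: "Gs \<noteq> []" using chain by (simp add: rational_chain_def)
  define I where "I = {i. i < length Gs \<and> Gs ! i \<subseteq> M}"
  have "0 \<in> I" using P.convexD(2)[OF M] chain(2) ne by (simp add: I_def hd_conv_nth)
  have "finite I" by (simp add: I_def)
  define i where "i = Max I"
  have "i \<in> I" unfolding i_def using Max_in[OF \<open>finite I\<close>] \<open>0 \<in> I\<close> by blast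
  then have i: "i < length Gs" "Gs ! i \<subseteq> M" by (simp_all add: I_def)
  have "M = Gs ! i"
  proof (cases "Suc i < length Gs")
    case True
    have step: "rational_step G (Gs ! i) (Gs ! Suc i)" using chain True by (simp add: rational_chain_def)
    have "Suc i \<notin> I" using Max_ge[OF \<open>finite I\<close>, of "Suc i"] by (auto simp: i_def)
    then have neg: "\<not> Gs ! Suc i \<subseteq> M" using True by (simp add: I_def)
    then have "M \<subseteq> Gs ! Suc i" using P.convex_chain[OF M conv[of "Gs ! Suc i"]] True by auto
    have "M \<subseteq> Gs ! i"
    proof (rule ccontr)
      assume "\<not> ?thesis"
      then obtain x where x: "x \<in> M" "x \<notin> Gs ! i" by blast
      have "y \<in> M" if y: "y \<in> Gs ! Suc i" for y
        using P.convex_commensurable[OF M i(2) x(1)] rational_step_commensurable[OF step _ x(2) y]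
          x(1) \<open>M \<subseteq> Gs ! Suc i\<close> y P.convexD(3)[OF conv[of "Gs ! Suc i"]] True by auto
      then show False using neg by blast
    qed
    then show ?thesis using i by blast
  next
    case False
    then have "Gs ! i = H" using chain(3) i(1) ne
      by (metis Suc_lessI diff_Suc_1 last_conv_nth)
    then show ?thesis using i(2) P.convexD(3)[OF M] by blast
  qed
  then show "M \<in> set Gs" using i by simp
qed (use conv in blast)

end

lemma sorted_psubset_unique:
  "sorted_wrt (\<subset>) xs \<Longrightarrow> sorted_wrt (\<subset>) ys \<Longrightarrow> set xs = set ys \<Longrightarrow> xs = ys"
proof (induction xs arbitrary: ys)
  case (Cons x xs)
  then obtain y ys' where ys: "ys = y # ys'" by (cases ys) auto
  have "x \<in> set (y # ys')" "y \<in> set (x # xs)" using Cons.prems(3) unfolding ys by auto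
  then have "x = y \<or> y \<subset> x" "x = y \<or> x \<subset> y" using Cons.prems(1,2) unfolding ys by auto
  then have "x = y" by blast
  moreover have "x \<notin> set xs" "y \<notin> set ys'" using Cons.prems ys by auto
  ultimately have "set xs = set ys'" using Cons.prems(3) ys by auto
  then show ?case using Cons ys \<open>x = y\<close> by auto
qed simp

context group
begin

text \<open>The order is built from \<open>Hs\<close>, so the terms of \<open>Hs\<close> are convex
  for it by construction. The terms of the jump-free \<open>Gs\<close> are convex for every
  Conradian order, in particular for this one. Both lists therefore enumerate the same strictly
  increasing family of convex subgroups.\<close>

lemma rational_chain_unique:
  assumes Gs: "rational_chain G Gs" "hd Gs = C" "last Gs = H" and jf: "jump_free G Gs"
    and Hs: "rational_chain G Hs" "hd Hs = C" "last Hs = H"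
  shows "Hs = Gs"
proof -
  have sorted: "sorted_wrt (\<subset>) Ks" if "rational_chain G Ks" for Ks
    using rational_chain_strict_mono[OF that] by (simp add: sorted_wrt_iff_nth_less)
  have ends: "Ks ! 0 = C" "Ks ! (length Ks - 1) = H" "Ks \<noteq> []" if "rational_chain G Ks" "hd Ks = C" "last Ks = H" for Ks
    using that by (auto simp: rational_chain_def hd_conv_nth last_conv_nth)
  obtain P where P: "conrad_cone G C H P" and convH: "\<And>j. j \<le> length Hs - 1 \<Longrightarrow> cone.convex G C H P (Hs ! j)"
    using rational_chain_cone_exists[OF Hs(1), of "length Hs - 1"] ends[OF Hs] by auto
  have convG: "cone.convex G C H P (Gs ! j)" if "j \<le> length Gs - 1" for j
    using jump_free_convex[OF Gs(1) jf, of "length Gs - 1" P j] P that ends[OF Gs] by simp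
  have c: "cone G C H P" using P conrad_cone_iff by blast
  have "set Hs = {M. cone.convex G C H P M}"
    using set_rational_chain[OF Hs c] convH by (metis Suc_pred' in_set_conv_nth length_pos_if_in_set less_Suc_eq_le)
  moreover have "set Gs = {M. cone.convex G C H P M}"
    using set_rational_chain[OF Gs c] convG by (metis Suc_pred' in_set_conv_nth length_pos_if_in_set less_Suc_eq_le)
  ultimately show ?thesis using sorted_psubset_unique sorted Hs(1) Gs(1) by metis
qed

end

section \<open>Orders determined by a finite set of positive elements\<close>

locale isolated_cone = conrad_cone +
  fixes F :: "'a set"
  assumes F_finite: "finite F" and F_P: "F \<subseteq> P"
    and F_unique: "conrad_cone G K H S \<Longrightarrow> F \<subseteq> S \<Longrightarrow> S = P"
begin

text \<open>A cone \<open>S\<close> on the layer \<open>N - M\<close> that contains the elements of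
  \<open>F\<close> in that layer can be spliced into \<open>P\<close> without losing any element of
  \<open>F\<close>, so it equals the layer of \<open>P\<close>. Thus finitely many elements
  determine the order on the layer, and one of them is the required \<open>s\<close>.\<close>

lemma F_meets_convex:
  assumes M: "convex M" and N: "convex N" and "M \<subset> N" and ab: "abelian_over G M N"
  obtains s where "s \<in> F \<inter> N - M" "\<And>x. x \<in> N \<Longrightarrow> commensurable G M s x"
proof -
  note Ns = convexD(1-3)[OF N] and Ms = convexD(1-3)[OF M]
  interpret A: abelian_step G M N
    using Ns Ms assms(3) ab by (intro abelian_step.intro abelian_step_axioms.intro is_group) auto
  interpret R: cone G K N "P \<inter> N" using cone_restrict[OF Ns] .
  have "R.convex M" using convex_restrict[OF M Ns] assms(3) by (metis Int_absorb2 psubset_imp_subset)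
  then have c: "cone G M N (P \<inter> N - M)" by (rule R.cone_convex_quotient)
  have "S = P \<inter> N - M" if S: "cone G M N S" "F \<inter> N - M \<subseteq> S" for S
  proof -
    interpret S: cone G M N S by fact
    have "conrad_cone G K H (P \<inter> M \<union> (S \<union> (P - N)))"
      unfolding conrad_cone_iff using cone_replace[OF M N S(1)] conrad_P S.abelian_conrad[OF ab] by blast
    moreover have "F \<subseteq> P \<inter> M \<union> (S \<union> (P - N))" using F_P S(2) by blast
    ultimately have "P \<inter> M \<union> (S \<union> (P - N)) = P" by (rule F_unique)
    then show ?thesis using S.P_K S.P_le_H assms(3) by blast
  qed
  then show ?thesis
    using A.unique_cone_commensurable[OF c, of "F \<inter> N - M"] F_finite F_P assms(3) that by blast
qed

lemma convex_rational_step: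
  assumes "convex M" "convex N" "M \<subset> N" "abelian_over G M N"
  shows "rational_step G M N"
proof -
  obtain s where s: "s \<in> F \<inter> N - M" "\<And>x. x \<in> N \<Longrightarrow> commensurable G M s x"
    using F_meets_convex[OF assms] by blast
  have "abelian_step G M N"
    using convexD[OF assms(1)] convexD[OF assms(2)] assms(3,4)
    by (intro abelian_step.intro abelian_step_axioms.intro is_group) auto
  moreover have "x \<in> M" if "x \<in> N" "n > 0" "x [^] n \<in> M" for x and n :: nat
    using convex_pow[OF assms(1)] that convexD(3)[OF assms(2)] by blast
  ultimately show ?thesis using s unfolding rational_step_def by blast
qed

lemma under_psubset_hull: "b \<in> P \<Longrightarrow> under b \<subset> hull_of b"
  using under_subset_hull mem_hull not_mem_under by blast

text \<open>Among the elements of \<open>F\<close> in \<open>M\<close>, one with maximal hull has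
  hull equal to \<open>M\<close>. Removing the jump at this element leaves a convex subgroup with
  fewer elements of \<open>F\<close>.\<close>

lemma chain_to_convex:
  "convex M \<Longrightarrow> \<exists>Gs. rational_chain G Gs \<and> hd Gs = K \<and> last Gs = M \<and> (\<forall>L\<in>set Gs. convex L)"
proof (induction "card (F \<inter> M)" arbitrary: M rule: less_induct)
  case less
  note M = less(2)
  show ?case
  proof (cases "M = K")
    case True
    then show ?thesis
      using convex_K K_subgroup by (intro exI[of _ "[K]"]) (auto simp: rational_chain_def)
  next
    case False
    have meets: "\<exists>f\<in>F. f \<in> hull_of x \<and> f \<notin> under x" if "x \<in> P" for x
      using F_meets_convex[OF convex_under[OF that] convex_hull[OF that] under_psubset_hull[OF that] jump_abelian[OF that]]
      by blast
    obtain x where x: "x \<in> P" "x \<in> M"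
    proof -
      obtain y where y: "y \<in> M" "y \<notin> K" using False convexD(2)[OF M] by blast
      then show ?thesis
        using that P_cases[of y] convexD(3)[OF M] subgroup.m_inv_closed[OF convexD(1)[OF M] y(1)] by blast
    qed
    have "F \<inter> M \<noteq> {}" using meets[OF x(1)] hull_least[OF M x] by blast
    then have "hull_of ` (F \<inter> M) \<noteq> {}" "finite (hull_of ` (F \<inter> M))" using F_finite by auto
    then obtain L where L: "L \<in> hull_of ` (F \<inter> M)" "\<And>N. N \<in> hull_of ` (F \<inter> M) \<Longrightarrow> L \<subseteq> N \<Longrightarrow> L = N"
      using finite_has_maximal[of "hull_of ` (F \<inter> M)"] by blast
    from L(1) obtain f where f: "f \<in> F" "f \<in> M" "L = hull_of f" by blast
    have f_max: "hull_of g = hull_of f" if "g \<in> F" "g \<in> M" "hull_of f \<subseteq> hull_of g" for g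
      using L(2)[of "hull_of g"] f(3) that by blast
    have fP: "f \<in> P" using f F_P by blast
    \<comment> \<open>The jump at \<open>y\<close> contains some \<open>g\<close> of
      \<open>F\<close>, and \<open>y\<close> lies in the hull of \<open>g\<close> because
      \<open>g\<close> is not under \<open>y\<close>. That hull lies in the maximal one, as hulls
      are comparable.\<close>
    have P_hull: "y \<in> hull_of f" if y: "y \<in> P" "y \<in> M" for y
    proof -
      obtain g where g: "g \<in> F" "g \<in> hull_of y" "g \<notin> under y" using meets[OF y(1)] by blast
      then have "g \<in> M" "g \<in> P" using hull_least[OF M y] F_P by auto
      have "hull_of g \<subseteq> hull_of f"
        using convex_chain[OF convex_hull[OF fP] convex_hull[OF \<open>g \<in> P\<close>]] f_max[OF g(1) \<open>g \<in> M\<close>] by blast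
      then show ?thesis using mem_hull_of_not_under[OF \<open>g \<in> P\<close> y(1) g(3)] by blast
    qed
    have "M \<subseteq> hull_of f"
    proof
      fix y assume y: "y \<in> M"
      then have "y \<in> H" using convexD(3)[OF M] by blast
      then show "y \<in> hull_of f"
      proof (cases rule: P_cases3)
        case neg
        then have "inv y \<in> hull_of f" using P_hull y subgroup.m_inv_closed[OF convexD(1)[OF M]] by blast
        then show ?thesis
          using subgroup_inv_iff[OF convexD(1)[OF convex_hull[OF fP]]] \<open>y \<in> H\<close> by simp
      next
        case zero
        then show ?thesis using convexD(2)[OF convex_hull[OF fP]] by blast
      qed (use P_hull y in blast)
    qed
    then have eq: "hull_of f = M" using hull_least[OF M fP f(2)] by blast
    have sub: "under f \<subset> M" using under_psubset_hull[OF fP] eq by simp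
    have "F \<inter> under f \<subset> F \<inter> M" using sub f not_mem_under[of f] by blast
    then have "card (F \<inter> under f) < card (F \<inter> M)" using F_finite by (simp add: psubset_card_mono)
    then obtain Gs where Gs: "rational_chain G Gs" "hd Gs = K" "last Gs = under f" "\<forall>L\<in>set Gs. convex L"
      using less(1) convex_under[OF fP] by blast
    have step: "rational_step G (under f) M"
      using convex_rational_step[OF convex_under[OF fP] M sub] jump_abelian[OF fP] eq by simp
    have ne: "Gs \<noteq> []" using Gs by (simp add: rational_chain_def)
    have "rational_step G ((Gs @ [M]) ! i) ((Gs @ [M]) ! Suc i)" if i: "Suc i < length (Gs @ [M])" for i
    proof (cases "Suc i < length Gs")
      case True
      then show ?thesis using Gs(1) by (simp add: rational_chain_def nth_append)
    next
      case False
      then have "i = length Gs - 1" "i < length Gs" "Suc i = length Gs" using i ne by simp_all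
      then show ?thesis using step Gs(3) ne by (simp add: nth_append last_conv_nth)
    qed
    then have "rational_chain G (Gs @ [M])"
      using Gs(1) convexD(1)[OF M] unfolding rational_chain_def by auto
    then show ?thesis using Gs M ne by (intro exI[of _ "Gs @ [M]"]) auto
  qed
qed

text \<open>All terms of the constructed chain are convex. An abelian jump would be a single
  rational step between convex subgroups, with the middle term as a convex subgroup strictly in
  between.\<close>

lemma jump_free_chain_exists:
  "\<exists>Gs. rational_chain G Gs \<and> hd Gs = K \<and> last Gs = H \<and> jump_free G Gs"
proof -
  obtain Gs where Gs: "rational_chain G Gs" "hd Gs = K" "last Gs = H" "\<forall>L\<in>set Gs. convex L"
    using chain_to_convex[OF convex_H] by blast
  have "\<not> abelian_step G (Gs ! i) (Gs ! (i + 2))" if i: "i + 2 < length Gs" for i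
  proof
    assume "abelian_step G (Gs ! i) (Gs ! (i + 2))"
    then have ab: "abelian_over G (Gs ! i) (Gs ! (i + 2))" by (simp add: abelian_step.ab)
    have strict: "Gs ! i \<subset> Gs ! (i + 1)" "Gs ! (i + 1) \<subset> Gs ! (i + 2)" "Gs ! i \<subset> Gs ! (i + 2)"
      using rational_chain_strict_mono[OF Gs(1)] i by auto
    have conv: "convex (Gs ! i)" "convex (Gs ! (i + 1))" "convex (Gs ! (i + 2))" using Gs(4) i by auto
    have step: "rational_step G (Gs ! i) (Gs ! (i + 2))"
      using convex_rational_step[OF conv(1,3) strict(3) ab] .
    obtain x where x: "x \<in> Gs ! (i + 1)" "x \<notin> Gs ! i" using strict by blast
    have "y \<in> Gs ! (i + 1)" if y: "y \<in> Gs ! (i + 2)" for y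
      using convex_commensurable[OF conv(2) _ x(1)] rational_step_commensurable[OF step _ x(2) y]
        strict x(1) y convexD(3)[OF conv(3)] by blast
    then show False using strict by blast
  qed
  then show ?thesis using Gs unfolding jump_free_def by blast
qed

end

section \<open>Left-preorders and their positive cones\<close>

context group
begin

lemma positive_coneD:
  assumes "\<alpha> \<in> positive_cone G R" shows "\<alpha> \<in> carrier G" "strictly R \<one> \<alpha>"
  using assms by (simp_all add: positive_cone_def)

lemma strictly_iff_positive_cone:
  assumes R: "left_preorder G R" and xy: "x \<in> carrier G" "y \<in> carrier G"
  shows "strictly R x y \<longleftrightarrow> inv x \<otimes> y \<in> positive_cone G R"
proof -
  have L: "(\<gamma> \<otimes> u, \<gamma> \<otimes> v) \<in> R" if "\<gamma> \<in> carrier G" "(u, v) \<in> R" for \<gamma> u v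
    using R that unfolding left_preorder_def by blast
  have "(x, y) \<in> R \<longleftrightarrow> (\<one>, inv x \<otimes> y) \<in> R" "(y, x) \<in> R \<longleftrightarrow> (inv x \<otimes> y, \<one>) \<in> R"
    using L[of "inv x" x y] L[of "inv x" y x] L[of x \<one> "inv x \<otimes> y"] L[of x "inv x \<otimes> y" \<one>] xy by auto
  then show ?thesis using xy by (simp add: strictly_def positive_cone_def)
qed

lemma conrad_cone_of_CO:
  assumes "subgroup C G" and R: "R \<in> CO G C"
  shows "conrad_cone G C (carrier G) (positive_cone G R)"
proof -
  have lp: "left_preorder G R" and con: "conradian G R" and res: "preorder_residue G R = C"
    using R by (simp_all add: CO_def)
  have L: "(\<gamma> \<otimes> u, \<gamma> \<otimes> v) \<in> R" if "\<gamma> \<in> carrier G" "(u, v) \<in> R" for \<gamma> u v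
    using lp that unfolding left_preorder_def by blast
  have trans: "(u, w) \<in> R" if "(u, v) \<in> R" "(v, w) \<in> R" for u v w
    using lp that unfolding left_preorder_def preorder_on_def by (blast dest: transD)
  have tot: "(u, v) \<in> R \<or> (v, u) \<in> R" if "u \<in> carrier G" "v \<in> carrier G" for u v
    using lp that by (cases "u = v") (simp_all add: left_preorder_def preorder_on_def refl_on_def total_on_def)
  have inv_iff: "inv x \<in> positive_cone G R \<longleftrightarrow> strictly R x \<one>" if "x \<in> carrier G" for x
    using strictly_iff_positive_cone[OF lp that one_closed] that by simp
  have P_iff: "x \<in> positive_cone G R \<longleftrightarrow> strictly R \<one> x" if "x \<in> carrier G" for x
    using that by (simp add: positive_cone_def)
  have "cone G C (carrier G) (positive_cone G R)"
  proof (rule coneI)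
    fix x y assume x: "x \<in> positive_cone G R" and y: "y \<in> positive_cone G R"
    have c: "x \<in> carrier G" "y \<in> carrier G" using x y positive_coneD by blast+
    have "(\<one>, x) \<in> R" "(x, \<one>) \<notin> R" "(\<one>, y) \<in> R" using x y by (auto simp: positive_cone_def strictly_def)
    moreover have "(x, x \<otimes> y) \<in> R" using L[of x \<one> y] \<open>(\<one>, y) \<in> R\<close> c by simp
    ultimately have "(\<one>, x \<otimes> y) \<in> R" "(x \<otimes> y, \<one>) \<notin> R" using trans by blast+
    then show "x \<otimes> y \<in> positive_cone G R" using c by (simp add: positive_cone_def strictly_def)
  next
    fix x assume "x \<in> carrier G"
    then show "x \<in> positive_cone G R \<or> inv x \<in> positive_cone G R \<or> x \<in> C"
      using tot[of x \<one>] P_iff inv_iff res by (auto simp: strictly_def preorder_residue_def)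
  next
    fix x assume x: "x \<in> positive_cone G R"
    have c: "x \<in> carrier G" using x positive_coneD by blast
    then show "inv x \<notin> positive_cone G R" using inv_iff x by (auto simp: positive_cone_def strictly_def)
    show "x \<notin> C" using x res by (auto simp: positive_cone_def strictly_def preorder_residue_def)
  qed (use assms(1) subgroup_self subgroup.subset positive_coneD in auto)
  moreover have "conrad G (positive_cone G R)"
    unfolding conrad_def
  proof (intro ballI)
    fix a b assume ab: "a \<in> positive_cone G R" "b \<in> positive_cone G R"
    have c: "a \<in> carrier G" "b \<in> carrier G" using ab positive_coneD by blast+
    then obtain n :: nat where "strictly R a (b \<otimes> a [^] n)"
      using con ab P_iff unfolding conradian_def by blast
    then show "\<exists>n::nat. inv a \<otimes> (b \<otimes> a [^] n) \<in> positive_cone G R"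
      using strictly_iff_positive_cone[OF lp c(1), of "b \<otimes> a [^] n"] c by auto
  qed
  ultimately show ?thesis by (simp add: conrad_cone_iff)
qed

lemma CO_of_conrad_cone:
  assumes "conrad_cone G C (carrier G) P" "C \<noteq> carrier G"
  obtains R where "R \<in> CO G C" "positive_cone G R = P"
proof -
  interpret conrad_cone G C "carrier G" P by fact
  \<comment> \<open>The relation is the negation of y < x, so that incomparability caused by
    \<open>C\<close> becomes equivalence.\<close>
  define R where "R = {(x, y) \<in> carrier G \<times> carrier G. inv y \<otimes> x \<notin> P}"
  have R_iff: "(x, y) \<in> R \<longleftrightarrow> inv y \<otimes> x \<notin> P" if "x \<in> carrier G" "y \<in> carrier G" for x y
    using that by (simp add: R_def)
  have strict: "strictly R x y \<longleftrightarrow> inv x \<otimes> y \<in> P" if "x \<in> carrier G" "y \<in> carrier G" for x y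
    using P_inv[of "inv x \<otimes> y"] that by (auto simp: strictly_def R_iff inv_mult_group)
  have pc: "positive_cone G R = P"
    using strict[OF one_closed] by (auto simp: positive_cone_def)
  have "trans R"
  proof (rule transI)
    fix x y z assume "(x, y) \<in> R" "(y, z) \<in> R"
    then have c: "x \<in> carrier G" "y \<in> carrier G" "z \<in> carrier G" and
      n: "inv y \<otimes> x \<notin> P" "inv z \<otimes> y \<notin> P" by (auto simp: R_def)
    have "inv z \<otimes> x \<notin> P"
    proof
      assume zx: "inv z \<otimes> x \<in> P"
      have "inv x \<otimes> y \<in> P \<or> inv x \<otimes> y \<in> C"
        using P_cases[of "inv x \<otimes> y"] n(1) c by (auto simp: inv_mult_group)
      then have "inv z \<otimes> x \<otimes> (inv x \<otimes> y) \<in> P" using zx P_mult P_mult_K by blast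
      then show False using n(2) c by (simp add: m_assoc)
    qed
    then show "(x, z) \<in> R" using c by (simp add: R_def)
  qed
  moreover have "refl_on (carrier G) R" using one_notin_P by (auto simp: R_def refl_on_def)
  moreover have "total_on (carrier G) R"
    unfolding total_on_def using strict R_iff unfolding strictly_def by blast
  moreover have "(a \<otimes> x, a \<otimes> y) \<in> R" if "a \<in> carrier G" "(x, y) \<in> R" for a x y
    using that by (auto simp: R_def inv_mult_group m_assoc)
  moreover have "R \<noteq> carrier G \<times> carrier G"
  proof -
    \<comment> \<open>Properness of \<open>C\<close> provides a positive element, which witnesses
      that the preorder is not the trivial relation.\<close>
    obtain x where "x \<in> carrier G" "x \<notin> C" using assms(2) K_le_H by blast
    then obtain p where p: "p \<in> P" using P_cases by blast
    then have "(p, \<one>) \<notin> R" by (simp add: R_def)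
    then show ?thesis using p by auto
  qed
  moreover have "R \<subseteq> carrier G \<times> carrier G" by (auto simp: R_def)
  ultimately have "left_preorder G R"
    unfolding left_preorder_def preorder_on_def by blast
  moreover have "preorder_residue G R = C"
  proof -
    have "x \<in> carrier G \<and> x \<notin> P \<and> inv x \<notin> P \<longleftrightarrow> x \<in> C" for x
      using P_cases[of x] P_K[of x] inv_P_notin_K[of x] by auto
    moreover have "(x, \<one>) \<in> R \<longleftrightarrow> x \<notin> P" "(\<one>, x) \<in> R \<longleftrightarrow> inv x \<notin> P" if "x \<in> carrier G" for x
      using R_iff[of x \<one>] R_iff[of \<one> x] that by simp_all
    ultimately show ?thesis unfolding preorder_residue_def by blast
  qed
  moreover have "conradian G R"
    unfolding conradian_def
  proof (intro ballI impI)
    fix a b assume ab: "a \<in> carrier G" "b \<in> carrier G" "strictly R \<one> a \<and> strictly R \<one> b"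
    then have "a \<in> P" "b \<in> P" using strict[of \<one>] by auto
    then show "\<exists>n::nat. strictly R a (b \<otimes> a [^] n)"
      using conrad_P ab(1,2) strict unfolding conrad_def by (metis m_closed nat_pow_closed)
  qed
  ultimately show ?thesis using that[of R] pc by (simp add: CO_def)
qed

lemma bij_betw_positive_cone:
  assumes "subgroup C G" "C \<noteq> carrier G"
  shows "bij_betw (positive_cone G) (CO G C) {P. conrad_cone G C (carrier G) P}"
  unfolding bij_betw_def
proof
  show "inj_on (positive_cone G) (CO G C)"
  proof (rule inj_onI)
    fix R S assume "R \<in> CO G C" "S \<in> CO G C" and eq: "positive_cone G R = positive_cone G S"
    then have lp: "left_preorder G R" "left_preorder G S" by (simp_all add: CO_def)
    have "sign_map G R = sign_map G S" unfolding sign_map_def eq ..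
    then show "R = S" using inj_on_sign_map[OF is_group] lp unfolding inj_on_def by blast
  qed
  show "positive_cone G ` CO G C = {P. conrad_cone G C (carrier G) P}"
    using conrad_cone_of_CO[OF assms(1)] CO_of_conrad_cone[OF _ assms(2)] by blast
qed

lemma sign_map_eq:
  assumes "\<alpha> \<in> carrier G"
  shows "sign_map G R \<alpha> = (if \<alpha> \<in> positive_cone G R then 1 else if inv \<alpha> \<in> positive_cone G R then - 1 else 0)"
proof -
  have "\<alpha> \<in> set_inv (positive_cone G R) \<longleftrightarrow> inv \<alpha> \<in> positive_cone G R"
    using assms positive_coneD(1)[of _ R] by (force simp: SET_INV_def)
  then show ?thesis using assms by (simp add: sign_map_def)
qed

text \<open>A basic open set constrains finitely many signs. A prescribed sign -1 is the condition
  that the inverse be positive, and elements of sign 0 are the same for all orders because the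
  residue \<open>C\<close> is fixed. So prescribing positive elements suffices.\<close>

lemma isolated_point_iff:
  assumes "subgroup C G" "R \<in> CO G C"
  shows "isolated_point (CO_space G C) R \<longleftrightarrow>
    (\<exists>F. finite F \<and> F \<subseteq> positive_cone G R \<and> (\<forall>S\<in>CO G C. F \<subseteq> positive_cone G S \<longrightarrow> S = R))"
    (is "_ \<longleftrightarrow> ?r")
proof
  assume "isolated_point (CO_space G C) R"
  then obtain V where V: "openin (product_topology (\<lambda>_. discrete_topology {- 1, 0, 1}) (carrier G)) V"
    "{R} = sign_map G -` V \<inter> CO G C"
    unfolding isolated_point_def CO_space_def openin_pullback_topology by blast
  then have "sign_map G R \<in> V" by blast
  then obtain U where U: "finite {i \<in> carrier G. U i \<noteq> {- 1, 0, 1 :: int}}"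
    "sign_map G R \<in> Pi\<^sub>E (carrier G) U" "Pi\<^sub>E (carrier G) U \<subseteq> V"
    using V(1) unfolding openin_product_topology_alt topspace_discrete_topology by blast
  define J where "J = {i \<in> carrier G. U i \<noteq> {- 1, 0, 1 :: int}}"
  \<comment> \<open>For each constrained coordinate outside \<open>C\<close>, exactly one of the
    element and its inverse is kept, namely the positive one.\<close>
  define F where "F = (J \<union> (\<lambda>i. inv i) ` J) \<inter> positive_cone G R"
  have "S = R" if S: "S \<in> CO G C" "F \<subseteq> positive_cone G S" for S
  proof -
    interpret R: conrad_cone G C "carrier G" "positive_cone G R" using conrad_cone_of_CO assms by blast
    interpret S: conrad_cone G C "carrier G" "positive_cone G S" using conrad_cone_of_CO assms(1) S(1) by blast
    have "sign_map G S i \<in> U i" if i: "i \<in> carrier G" for i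
    proof (cases "i \<in> J")
      case True
      have "sign_map G S i = sign_map G R i"
        using i
      proof (cases rule: R.P_cases3)
        case pos
        then have "i \<in> positive_cone G S" using True S(2) by (auto simp: F_def)
        then show ?thesis using pos i by (simp add: sign_map_eq)
      next
        case neg
        then have "inv i \<in> positive_cone G S" using True S(2) by (auto simp: F_def)
        then show ?thesis using neg i R.P_inv[of i] S.P_inv[of i] by (auto simp: sign_map_eq)
      next
        case zero
        then show ?thesis using R.P_K S.P_K R.inv_P_notin_K S.inv_P_notin_K i by (auto simp: sign_map_eq)
      qed
      then show ?thesis using U(2) i by (auto simp: PiE_iff)
    next
      case False
      then show ?thesis using i by (simp add: J_def sign_map_eq)
    qed
    then have "sign_map G S \<in> Pi\<^sub>E (carrier G) U" by (simp add: PiE_iff sign_map_def)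
    then show ?thesis using U(3) V(2) S(1) by blast
  qed
  moreover have "finite F" "F \<subseteq> positive_cone G R" using U(1) by (auto simp: F_def J_def)
  ultimately show ?r by blast
next
  assume ?r
  then obtain F where F: "finite F" "F \<subseteq> positive_cone G R" "\<And>S. S \<in> CO G C \<Longrightarrow> F \<subseteq> positive_cone G S \<Longrightarrow> S = R"
    by blast
  have Fc: "F \<subseteq> carrier G" using F(2) positive_coneD(1) by blast
  define U where "U = (\<lambda>i. if i \<in> F then {1} else {- 1, 0, 1 :: int})"
  have "finite {i \<in> carrier G. U i \<noteq> {- 1, 0, 1}}"
    by (rule finite_subset[OF _ F(1)]) (auto simp: U_def)
  moreover have "\<forall>i\<in>carrier G. openin (discrete_topology {- 1, 0, 1}) (U i)" by (simp add: U_def)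
  ultimately have "openin (product_topology (\<lambda>_. discrete_topology {- 1, 0, 1}) (carrier G)) (Pi\<^sub>E (carrier G) U)"
    unfolding openin_product_topology_alt topspace_discrete_topology by blast
  moreover have "sign_map G S \<in> Pi\<^sub>E (carrier G) U \<longleftrightarrow> F \<subseteq> positive_cone G S" for S
  proof -
    have "sign_map G S i \<in> U i \<longleftrightarrow> (i \<in> F \<longrightarrow> i \<in> positive_cone G S)" if "i \<in> carrier G" for i
      using that by (simp add: U_def sign_map_eq)
    moreover have "sign_map G S \<in> extensional (carrier G)" by (simp add: sign_map_def)
    ultimately show ?thesis using Fc by (auto simp: PiE_iff)
  qed
  then have "S \<in> sign_map G -` Pi\<^sub>E (carrier G) U \<inter> CO G C \<longleftrightarrow> S = R" for S
    using F(2,3) assms(2) by blast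
  then have "{R} = sign_map G -` Pi\<^sub>E (carrier G) U \<inter> CO G C" by blast
  ultimately show "isolated_point (CO_space G C) R"
    unfolding isolated_point_def topspace_CO_space using assms(2)
    unfolding CO_space_def openin_pullback_topology by blast
qed

lemma isolated_point_chain:
  assumes "subgroup C G" "C \<noteq> carrier G" "R \<in> CO G C" "isolated_point (CO_space G C) R"
  shows "\<exists>Gs. rational_chain G Gs \<and> hd Gs = C \<and> last Gs = carrier G \<and> jump_free G Gs"
proof -
  obtain F where F: "finite F" "F \<subseteq> positive_cone G R" "\<And>S. S \<in> CO G C \<Longrightarrow> F \<subseteq> positive_cone G S \<Longrightarrow> S = R"
    using assms(4) isolated_point_iff[OF assms(1,3)] by blast
  have unique: "S = positive_cone G R" if S: "conrad_cone G C (carrier G) S" "F \<subseteq> S" for S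
  proof -
    obtain T where "T \<in> CO G C" "positive_cone G T = S" using CO_of_conrad_cone[OF S(1) assms(2)] by blast
    then show ?thesis using F(3) S(2) by blast
  qed
  interpret isolated_cone G C "carrier G" "positive_cone G R" F
    by (rule isolated_cone.intro[OF conrad_cone_of_CO[OF assms(1,3)] isolated_cone_axioms.intro[OF F(1,2) unique]])
  show ?thesis by (rule jump_free_chain_exists)
qed

text \<open>Distinct cones are incomparable, so each other order \<open>S\<close> misses some
  positive element \<open>f S\<close> of \<open>R\<close>. Finitely many such elements separate
  \<open>R\<close> from all the others.\<close>

lemma finite_CO_isolated:
  assumes "subgroup C G" "finite (CO G C)" "R \<in> CO G C"
  shows "isolated_point (CO_space G C) R"
proof -
  have "\<exists>f. f \<in> positive_cone G R \<and> f \<notin> positive_cone G S" if S: "S \<in> CO G C" "S \<noteq> R" for S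
  proof (rule ccontr)
    assume "\<not> ?thesis"
    then have "positive_cone G R \<subseteq> positive_cone G S" by blast
    then have eq: "positive_cone G R = positive_cone G S"
      using cone.sub_cone_eq conrad_cone_of_CO[OF assms(1)] S(1) assms(3) conrad_cone_iff by metis
    have "sign_map G R = sign_map G S" unfolding sign_map_def eq ..
    then show False
      using inj_on_sign_map[OF is_group] S assms(3) unfolding inj_on_def CO_def by blast
  qed
  then obtain f where f: "\<And>S. S \<in> CO G C \<Longrightarrow> S \<noteq> R \<Longrightarrow> f S \<in> positive_cone G R \<and> f S \<notin> positive_cone G S"
    by metis
  have "finite (f ` (CO G C - {R}))" "f ` (CO G C - {R}) \<subseteq> positive_cone G R"
    "\<forall>S\<in>CO G C. f ` (CO G C - {R}) \<subseteq> positive_cone G S \<longrightarrow> S = R"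
    using assms(2) f by blast+
  then show ?thesis unfolding isolated_point_iff[OF assms(1,3)] by blast
qed

lemma card_CO:
  assumes "subgroup C G" "C \<noteq> carrier G"
    and Gs: "rational_chain G Gs" "hd Gs = C" "last Gs = carrier G" "jump_free G Gs"
  shows "card (CO G C) = 2 ^ series_length Gs"
proof -
  have "Gs \<noteq> []" using Gs(1) by (simp add: rational_chain_def)
  then have "card {P. conrad_cone G C (carrier G) P} = 2 ^ (length Gs - 1)"
    using card_conrad_cones[OF Gs(1,4), of "length Gs - 1"] Gs(2,3) by (simp add: hd_conv_nth last_conv_nth)
  then show ?thesis
    using bij_betw_same_card[OF bij_betw_positive_cone[OF assms(1,2)]] by (simp add: series_length_def)
qed

end

theorem theorem1p6:
  fixes G :: "('a, 'm) monoid_scheme" and C :: "'a set"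
  assumes "group G" and "subgroup C G" and "C \<noteq> carrier G"
  shows
    "let a = ((\<forall>R\<in>CO G C. isolated_point (CO_space G C) R) \<and> CO G C \<noteq> {});
         b = (\<exists>R\<in>CO G C. isolated_point (CO_space G C) R);
         c = (\<exists>Gs. rational_series_from G C Gs \<and> \<not> has_abelian_jump G Gs);
         d = (\<exists>Gs. rational_series_from G C Gs \<and>
                   (\<forall>Hs. rational_series_from G C Hs \<longrightarrow> Hs = Gs) \<and>
                   \<not> has_abelian_jump G Gs);
         e = (finite (CO G C) \<and> CO G C \<noteq> {})
     in (a \<longleftrightarrow> b) \<and> (b \<longleftrightarrow> c) \<and> (c \<longleftrightarrow> d) \<and> (d \<longleftrightarrow> e) \<and>
        (\<forall>Gs. rational_series_from G C Gs \<and> \<not> has_abelian_jump G Gs \<longrightarrow>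
              card (CO G C) = 2 ^ series_length Gs)"
proof -
  interpret group G by fact
  have series: "rational_series_from G C Gs \<longleftrightarrow> rational_chain G Gs \<and> hd Gs = C \<and> last Gs = carrier G" for Gs
    by (simp add: rational_series_from_def rational_series_iff_chain)
  have jump: "has_abelian_jump G Gs \<longleftrightarrow> \<not> jump_free G Gs" if "rational_series_from G C Gs" for Gs
    using that has_abelian_jump_iff by (auto simp: series rational_chain_def)
  have card: "card (CO G C) = 2 ^ series_length Gs"
    if "rational_series_from G C Gs" "\<not> has_abelian_jump G Gs" for Gs
    using that card_CO[OF assms(2,3)] jump series by blast
  have b_c: "\<exists>Gs. rational_series_from G C Gs \<and> \<not> has_abelian_jump G Gs"
    if "R \<in> CO G C" "isolated_point (CO_space G C) R" for R
    using isolated_point_chain[OF assms(2,3) that] series jump by blast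
  have c_d: "Hs = Gs"
    if "rational_series_from G C Gs" "\<not> has_abelian_jump G Gs" "rational_series_from G C Hs" for Gs Hs
    using rational_chain_unique[of Gs C "carrier G" Hs] that series[of Gs] series[of Hs] jump[of Gs] by blast
  have c_e: "finite (CO G C) \<and> CO G C \<noteq> {}"
    if "rational_series_from G C Gs" "\<not> has_abelian_jump G Gs" for Gs
    \<comment> \<open>Infinite sets have cardinality 0 by convention, so a positive cardinality
      gives finiteness and non-emptiness at once.\<close>
    using card[OF that] card_gt_0_iff[of "CO G C"] by simp
  have e_a: "\<forall>R\<in>CO G C. isolated_point (CO_space G C) R" if "finite (CO G C)"
    using finite_CO_isolated[OF assms(2) that] by blast
  let ?a = "(\<forall>R\<in>CO G C. isolated_point (CO_space G C) R) \<and> CO G C \<noteq> {}"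
  let ?b = "\<exists>R\<in>CO G C. isolated_point (CO_space G C) R"
  let ?c = "\<exists>Gs. rational_series_from G C Gs \<and> \<not> has_abelian_jump G Gs"
  let ?d = "\<exists>Gs. rational_series_from G C Gs \<and>
    (\<forall>Hs. rational_series_from G C Hs \<longrightarrow> Hs = Gs) \<and> \<not> has_abelian_jump G Gs"
  let ?e = "finite (CO G C) \<and> CO G C \<noteq> {}"
  have "?a \<Longrightarrow> ?b" by blast
  moreover have "?b \<Longrightarrow> ?c" using b_c by blast
  moreover have "?c \<Longrightarrow> ?d" using c_d by blast
  moreover have "?d \<Longrightarrow> ?c" by blast
  moreover have "?c \<Longrightarrow> ?e" using c_e by blast
  moreover have "?e \<Longrightarrow> ?a" using e_a by blast
  ultimately have "(?a \<longleftrightarrow> ?b) \<and> (?b \<longleftrightarrow> ?c) \<and> (?c \<longleftrightarrow> ?d) \<and> (?d \<longleftrightarrow> ?e)" by argo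
  then show ?thesis unfolding Let_def using card by blast
qed

end
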